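(* Let $(\Omega,\Sigma,\mu)$ and $(\Omega,\Sigma,\nu)$ be two $\sigma$-finite measure spaces, let $p,q\in[1,+\infty]$, and let $g\in L_0(\Omega,\mu)$ be such that the multiplication operator $M_g:L_p(\Omega,\mu)\to L_q(\Omega,\nu)$, $f\mapsto g\cdot f$, is a well-defined bounded operator. Let $\nu=\rho_{\nu,\mu}\cdot\mu+\nu_s$ be the Lebesgue decomposition of $\nu$ with respect to $\mu$, with $\Omega=\Omega_c\sqcup\Omega_s$ and $\mu(\Omega_s)=\nu_s(\Omega_c)=0$. Then the following are equivalent: i) $M_g\in\mathcal{B}(L_p(\Omega,\mu),L_q(\Omega,\nu))$ is topologically injective; ii) $M_g^{\Omega_c}:L_p(\Omega_c,\mu|_{\Omega_c})\to L_q(\Omega_c,\nu|_{\Omega_c})$ is an isomorphism; iii) $\rho_{\nu,\mu}$ is positive, $|g\cdot\rho_{\nu,\mu}^{1/q}|_{\Omega_c}|\geq c$ for some constant $c>0$, and if $p\neq q$ the space $(\Omega,\Sigma,\mu)$ consists of finitely many atoms.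
   Context: All linear spaces are over $\mathbb{C}$; measures are nonnegative, $\sigma$-additive, with values in $[0,+\infty]$. $L_0(\Omega,\mu)$ is the space of measurable complex functions on $\Omega$. If $p=\infty$ then $1/p=0$. Equalities and inequalities between functions (including positivity) are understood up to sets of measure zero (here with respect to $\mu$). For a nonnegative measurable $\rho$, $(\rho\cdot\mu)(E)=\int_E\rho\,d\mu$. Lebesgue decomposition of $\nu$ with respect to $\mu$: a nonnegative measurable function $\rho_{\nu,\mu}$, a $\sigma$-finite measure $\nu_s$ and a set $\Omega_s\in\Sigma$ such that $\nu=\rho_{\nu,\mu}\cdot\mu+\nu_s$ and $\mu(\Omega_s)=\nu_s(\Omega_c)=0$, where $\Omega_c=\Omega\setminus\Omega_s$. For $E\in\Sigma$, $M_g^E:L_p(E,\mu|_E)\to L_q(E,\nu|_E)$ is the operator $f\mapsto g|_E\cdot f$. A bounded operator $T:X\to Y$ between normed spaces is topologically injective if there is $c>0$ with $\|T(x)\|\geq c\|x\|$ for all $x\in X$. An isomorphism is a bounded linear bijection with bounded inverse. An atom of $(\Omega,\Sigma,\mu)$ is a set $\Omega'\in\Sigma$ with $\mu(\Omega')>0$ such that for every $E\in\Sigma$ with $E\subset\Omega'$ either $\mu(E)=0$ or $\mu(\Omega'\setminus E)=0$. "$(\Omega,\Sigma,\mu)$ consists of finitely many atoms" means that, up to a $\mu$-null set, $\Omega$ is a finite disjoint union of atoms. *)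

theory Defs
  imports "HOL-Probability.Essential_Supremum"
begin

text \<open>The spaces below depend on measures and exponents, hence on terms, so they are given by
  explicit carriers and not by the type class of real normed vector spaces.\<close>

record 'v cnormed =
  carrier :: "'v set"
  add :: "'v \<Rightarrow> 'v \<Rightarrow> 'v"
  scale :: "complex \<Rightarrow> 'v \<Rightarrow> 'v"
  nrm :: "'v \<Rightarrow> real"

definition bounded_operator :: "'u cnormed \<Rightarrow> 'v cnormed \<Rightarrow> ('u \<Rightarrow> 'v) \<Rightarrow> bool" where
  "bounded_operator X Y T \<longleftrightarrow>
     (\<forall>x\<in>carrier X. T x \<in> carrier Y) \<and>
     (\<forall>x\<in>carrier X. \<forall>y\<in>carrier X. T (add X x y) = add Y (T x) (T y)) \<and>
     (\<forall>a. \<forall>x\<in>carrier X. T (scale X a x) = scale Y a (T x)) \<and>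
     (\<exists>K. \<forall>x\<in>carrier X. nrm Y (T x) \<le> K * nrm X x)"

definition topologically_injective :: "'u cnormed \<Rightarrow> 'v cnormed \<Rightarrow> ('u \<Rightarrow> 'v) \<Rightarrow> bool" where
  "topologically_injective X Y T \<longleftrightarrow>
     bounded_operator X Y T \<and> (\<exists>c>0. \<forall>x\<in>carrier X. nrm Y (T x) \<ge> c * nrm X x)"

definition isomorphism :: "'u cnormed \<Rightarrow> 'v cnormed \<Rightarrow> ('u \<Rightarrow> 'v) \<Rightarrow> bool" where
  "isomorphism X Y T \<longleftrightarrow>
     bounded_operator X Y T \<and> bij_betw T (carrier X) (carrier Y) \<and>
     bounded_operator Y X (inv_into (carrier X) T)"

definition Lp_fun :: "'a measure \<Rightarrow> ennreal \<Rightarrow> ('a \<Rightarrow> complex) set" where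
  "Lp_fun M p = {f \<in> borel_measurable M.
     if p = \<infinity> then esssup M (\<lambda>x. ennreal (cmod (f x))) < \<infinity>
     else (\<integral>\<^sup>+x. ennreal (cmod (f x) powr enn2real p) \<partial>M) < \<infinity>}"

definition Lp_norm :: "'a measure \<Rightarrow> ennreal \<Rightarrow> ('a \<Rightarrow> complex) \<Rightarrow> real" where
  "Lp_norm M p f =
     (if p = \<infinity> then enn2real (esssup M (\<lambda>x. ennreal (cmod (f x))))
      else enn2real (\<integral>\<^sup>+x. ennreal (cmod (f x) powr enn2real p) \<partial>M) powr (1 / enn2real p))"

definition ae_eq :: "'a measure \<Rightarrow> (('a \<Rightarrow> complex) \<times> ('a \<Rightarrow> complex)) set" where
  "ae_eq M = {(f, h). f \<in> borel_measurable M \<and> h \<in> borel_measurable M \<and> (AE x in M. f x = h x)}"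

text \<open>Elements are classes modulo almost everywhere equality. An operation given on
  representatives is lifted to classes by taking the union of all the resulting classes; this
  union is again a class exactly when the result does not depend on the representatives. The norm
  is the common value of the seminorm on a class.\<close>

definition Lp :: "'a measure \<Rightarrow> ennreal \<Rightarrow> ('a \<Rightarrow> complex) set cnormed" where
  "Lp M p = \<lparr>
     carrier = Lp_fun M p // ae_eq M,
     add = (\<lambda>F H. \<Union>f\<in>F. \<Union>h\<in>H. ae_eq M `` {\<lambda>x. f x + h x}),
     scale = (\<lambda>a F. \<Union>f\<in>F. ae_eq M `` {\<lambda>x. a * f x}),
     nrm = (\<lambda>F. the_elem (Lp_norm M p ` F)) \<rparr>"

text \<open>Here \<open>N\<close> is the measure of the codomain. As the union need not be a class,
  that \<open>mult_op N g\<close> maps the carrier of \<open>Lp M p\<close> to that of \<open>Lp N q\<close> says that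
  \<open>g * f\<close> lies in \<open>Lp_fun N q\<close> for every \<open>f\<close> in \<open>Lp_fun M p\<close>, and
  that its class modulo \<open>N\<close> depends only on the class of \<open>f\<close> modulo \<open>M\<close>.\<close>

definition mult_op ::
  "'a measure \<Rightarrow> ('a \<Rightarrow> complex) \<Rightarrow> ('a \<Rightarrow> complex) set \<Rightarrow> ('a \<Rightarrow> complex) set" where
  "mult_op N g F = (\<Union>f\<in>F. ae_eq N `` {\<lambda>x. g x * f x})"

lemma equiv_ae_eq: "equiv (borel_measurable M) (ae_eq M)"
proof (rule equivI)
  show "ae_eq M \<subseteq> borel_measurable M \<times> borel_measurable M"
    by (auto simp: ae_eq_def)
  show "refl_on (borel_measurable M) (ae_eq M)"
    by (simp add: refl_on_def ae_eq_def)
  show "sym (ae_eq M)"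
    by (simp add: sym_def ae_eq_def eq_commute)
  show "trans (ae_eq M)"
  proof (rule transI)
    fix f h k assume "(f, h) \<in> ae_eq M" "(h, k) \<in> ae_eq M"
    moreover from this have "AE x in M. f x = h x" "AE x in M. h x = k x"
      by (simp_all add: ae_eq_def)
    then have "AE x in M. f x = k x"
      by eventually_elim simp
    ultimately show "(f, k) \<in> ae_eq M"
      by (simp add: ae_eq_def)
  qed
qed

lemma Lp_cong:
  assumes "(f, h) \<in> ae_eq M"
  shows Lp_fun_cong: "f \<in> Lp_fun M p \<longleftrightarrow> h \<in> Lp_fun M p"
    and Lp_norm_cong: "Lp_norm M p f = Lp_norm M p h"
proof -
  have m: "f \<in> borel_measurable M" "h \<in> borel_measurable M" and e: "AE x in M. f x = h x"
    using assms by (auto simp: ae_eq_def)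
  have 1: "esssup M (\<lambda>x. ennreal (cmod (f x))) = esssup M (\<lambda>x. ennreal (cmod (h x)))"
    by (rule esssup_AE_cong) (use m e in auto)
  have 2: "(\<integral>\<^sup>+x. ennreal (cmod (f x) powr r) \<partial>M) = (\<integral>\<^sup>+x. ennreal (cmod (h x) powr r) \<partial>M)" for r
    by (rule nn_integral_cong_AE) (use e in auto)
  show "f \<in> Lp_fun M p \<longleftrightarrow> h \<in> Lp_fun M p" "Lp_norm M p f = Lp_norm M p h"
    using m 1 2 by (auto simp: Lp_fun_def Lp_norm_def)
qed

lemma nrm_Lp_class:
  assumes "f \<in> borel_measurable M"
  shows "nrm (Lp M p) (ae_eq M `` {f}) = Lp_norm M p f"
proof -
  have ff: "(f, f) \<in> ae_eq M"
    using assms by (simp add: ae_eq_def)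
  have "Lp_norm M p h = Lp_norm M p f" if "h \<in> ae_eq M `` {f}" for h
    using Lp_norm_cong[of f h M p] that by simp
  moreover have "f \<in> ae_eq M `` {f}"
    using ff by simp
  ultimately have "Lp_norm M p ` (ae_eq M `` {f}) = {Lp_norm M p f}"
    by blast
  then show ?thesis
    by (simp add: Lp_def)
qed

lemma add_Lp_class:
  assumes "f \<in> borel_measurable M" "h \<in> borel_measurable M"
  shows "add (Lp M p) (ae_eq M `` {f}) (ae_eq M `` {h}) = ae_eq M `` {\<lambda>x. f x + h x}"
proof -
  have "congruent2 (ae_eq M) (ae_eq M) (\<lambda>f h. ae_eq M `` {\<lambda>x. f x + h x})"
  proof (rule congruent2I')
    fix f f' h h' assume "(f, f') \<in> ae_eq M" "(h, h') \<in> ae_eq M"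
    then have "((\<lambda>x. f x + h x), (\<lambda>x. f' x + h' x)) \<in> ae_eq M"
      by (auto simp: ae_eq_def)
    then show "ae_eq M `` {\<lambda>x. f x + h x} = ae_eq M `` {\<lambda>x. f' x + h' x}"
      by (rule equiv_class_eq[OF equiv_ae_eq])
  qed
  from UN_equiv_class2[OF equiv_ae_eq equiv_ae_eq this assms] show ?thesis
    by (simp add: Lp_def)
qed

lemma scale_Lp_class:
  assumes "f \<in> borel_measurable M"
  shows "scale (Lp M p) a (ae_eq M `` {f}) = ae_eq M `` {\<lambda>x. a * f x}"
proof -
  have "(\<lambda>f. ae_eq M `` {\<lambda>x. a * f x}) respects ae_eq M"
  proof (rule congruentI)
    fix f f' assume "(f, f') \<in> ae_eq M"
    then have "((\<lambda>x. a * f x), (\<lambda>x. a * f' x)) \<in> ae_eq M"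
      by (auto simp: ae_eq_def)
    then show "ae_eq M `` {\<lambda>x. a * f x} = ae_eq M `` {\<lambda>x. a * f' x}"
      by (rule equiv_class_eq[OF equiv_ae_eq])
  qed
  from UN_equiv_class[OF equiv_ae_eq this assms] show ?thesis
    by (simp add: Lp_def)
qed

lemma mult_op_carrier_iff:
  assumes "sets N = sets M" "g \<in> borel_measurable M"
  shows "(\<forall>F\<in>carrier (Lp M p). mult_op N g F \<in> carrier (Lp N q)) \<longleftrightarrow>
    (\<forall>f\<in>Lp_fun M p. (\<lambda>x. g x * f x) \<in> Lp_fun N q \<and>
       (\<forall>h\<in>Lp_fun M p. (AE x in M. f x = h x) \<longrightarrow> (AE x in N. g x * f x = g x * h x)))"
  (is "?L \<longleftrightarrow> ?R")
proof -
  have ms: "borel_measurable N = borel_measurable M"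
    using assms(1) by (intro measurable_cong_sets) auto
  have prod: "(\<lambda>x. g x * f x) \<in> borel_measurable N" if "f \<in> borel_measurable M" for f
    using that assms(2) by (simp add: ms)
  have meas: "f \<in> borel_measurable M" if "f \<in> Lp_fun M p" for f
    using that by (simp add: Lp_fun_def)
  show ?thesis
  proof
    assume L: ?L
    show ?R
    proof (intro ballI conjI impI)
      fix f assume f: "f \<in> Lp_fun M p"
      let ?F = "ae_eq M `` {f}"
      have "?F \<in> carrier (Lp M p)"
        using f by (auto simp: Lp_def quotient_def)
      with L have "mult_op N g ?F \<in> Lp_fun N q // ae_eq N"
        by (auto simp: Lp_def)
      then obtain k where k: "k \<in> Lp_fun N q" "mult_op N g ?F = ae_eq N `` {k}"
        by (rule quotientE)
      have *: "(k, \<lambda>x. g x * h x) \<in> ae_eq N" if "(f, h) \<in> ae_eq M" for h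
      proof -
        have "(\<lambda>x. g x * h x) \<in> mult_op N g ?F"
          unfolding mult_op_def using that prod[of h] by (auto simp: ae_eq_def)
        with k show ?thesis by auto
      qed
      have ff: "(f, f) \<in> ae_eq M"
        using meas[OF f] by (simp add: ae_eq_def)
      show "(\<lambda>x. g x * f x) \<in> Lp_fun N q"
        using Lp_fun_cong[OF *[OF ff]] k by blast
      fix h assume h: "h \<in> Lp_fun M p" "AE x in M. f x = h x"
      then have "(f, h) \<in> ae_eq M"
        using meas f by (simp add: ae_eq_def)
      from *[OF this] *[OF ff]
      have "AE x in N. k x = g x * h x" "AE x in N. k x = g x * f x"
        by (simp_all add: ae_eq_def)
      then show "AE x in N. g x * f x = g x * h x"
        by eventually_elim simp
    qed
  next
    assume R: ?R
    show ?L
    proof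
      fix F assume "F \<in> carrier (Lp M p)"
      then obtain f where f: "f \<in> Lp_fun M p" and F: "F = ae_eq M `` {f}"
        by (auto simp: Lp_def quotient_def)
      have ff: "(f, f) \<in> ae_eq M"
        using meas[OF f] by (simp add: ae_eq_def)
      have "ae_eq N `` {\<lambda>x. g x * h x} = ae_eq N `` {\<lambda>x. g x * f x}" if "h \<in> F" for h
      proof -
        have fh: "(f, h) \<in> ae_eq M"
          using that F by simp
        then have "h \<in> Lp_fun M p"
          using Lp_fun_cong f by blast
        with R f fh have "(\<lambda>x. g x * f x, \<lambda>x. g x * h x) \<in> ae_eq N"
          using prod by (auto simp: ae_eq_def)
        then show ?thesis
          using equiv_class_eq[OF equiv_ae_eq] by blast
      qed
      then have "mult_op N g F = ae_eq N `` {\<lambda>x. g x * f x}"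
        unfolding mult_op_def using F ff by blast
      then show "mult_op N g F \<in> carrier (Lp N q)"
        using R f by (auto simp: Lp_def quotient_def)
    qed
  qed
qed

definition lebesgue_decomposition ::
  "'a measure \<Rightarrow> 'a measure \<Rightarrow> ('a \<Rightarrow> real) \<Rightarrow> 'a measure \<Rightarrow> 'a set \<Rightarrow> bool" where
  "lebesgue_decomposition M N \<rho> Ns S \<longleftrightarrow>
     \<rho> \<in> borel_measurable M \<and> (AE x in M. 0 \<le> \<rho> x) \<and>
     sets Ns = sets M \<and> sigma_finite_measure Ns \<and>
     (\<forall>E\<in>sets M. emeasure N E = emeasure (density M (\<lambda>x. ennreal (\<rho> x))) E + emeasure Ns E) \<and>
     S \<in> sets M \<and> emeasure M S = 0 \<and> emeasure Ns (space M - S) = 0"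

definition atom :: "'a measure \<Rightarrow> 'a set \<Rightarrow> bool" where
  "atom M A \<longleftrightarrow> A \<in> sets M \<and> emeasure M A > 0 \<and>
     (\<forall>E\<in>sets M. E \<subseteq> A \<longrightarrow> emeasure M E = 0 \<or> emeasure M (A - E) = 0)"

definition finitely_many_atoms :: "'a measure \<Rightarrow> bool" where
  "finitely_many_atoms M \<longleftrightarrow> (\<exists>\<A>. finite \<A> \<and> disjoint \<A> \<and> (\<forall>A\<in>\<A>. atom M A) \<and>
     emeasure M (space M - \<Union>\<A>) = 0)"

end

theory Submission
  imports Defs
begin

text \<open>Let \<open>\<mu>\<close> and \<open>\<nu>\<close> be the two measures (\<open>M\<close> and
  \<open>N\<close> below). Multiplication by \<open>g\<close> is well defined on classes only if
  \<open>g\<close> vanishes \<open>\<nu>\<close>-almost everywhere on every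
  \<open>\<mu>\<close>-null set, in particular on the set that carries the singular part of
  \<open>\<nu>\<close>. So nothing happens outside \<open>\<Omega>\<^sub>c\<close>, and on
  \<open>\<Omega>\<^sub>c\<close> the measure \<open>\<nu>\<close> is \<open>\<rho> \<cdot>
  \<mu>\<close>. There the norm of \<open>g * f\<close> in \<open>L_q(\<nu>)\<close> is the norm
  of \<open>w * f\<close> in \<open>L_q(\<mu>)\<close>, where \<open>w\<close> is the product of
  \<open>g\<close> and the \<open>q\<close>-th root of \<open>\<rho>\<close>
  (\<open>Lp_le_density_iff\<close>). The theorem is thus about a bounded multiplication operator
  by \<open>w\<close> from \<open>L_p\<close> to \<open>L_q\<close> over one measure.

  Suppose that it is bounded below. A sum of \<open>m\<close> disjoint normalised blocks has norm
  \<open>m powr (1 / p)\<close> in \<open>L_p\<close>, while its image, consisting of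
  \<open>m\<close> disjoint blocks of comparable norms, has norm of the order of \<open>m powr (1
  / q)\<close>. If \<open>p \<noteq> q\<close> this bounds the number of disjoint nonnull sets
  (\<open>disjoint_family_bound\<close>), and a disjoint family of maximal size consists of atoms
  that exhaust the space (\<open>finitely_many_atoms_if_card_bounded\<close>). A lower bound for
  \<open>|w|\<close> comes from testing on indicators
  (\<open>density_multiplier_lower_bound\<close>); it also makes \<open>\<rho>\<close> positive.

  Conversely, if \<open>|w|\<close> is bounded below, then \<open>h / w\<close> lies in
  \<open>L_q\<close> for every \<open>h\<close> in \<open>L_q\<close>. If \<open>p = q\<close>
  this is the preimage. If \<open>p \<noteq> q\<close> there are finitely many atoms, and then
  \<open>L_q\<close> is contained in \<open>L_p\<close> with a bounded inclusion, because nonnull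
  sets cannot be arbitrarily small and the total measure is finite (\<open>Lp_le_of_gap\<close>).
  Either way multiplication by \<open>1 / g\<close> is a bounded inverse on
  \<open>\<Omega>\<^sub>c\<close>. An isomorphism on \<open>\<Omega>\<^sub>c\<close> is bounded
  below there, hence so is the operator on the whole space.\<close>

section \<open>Norm bounds for functions\<close>

text \<open>Membership and norm are bound together, since \<^const>\<open>Lp_norm\<close> also returns a
  real number for functions of infinite norm. A bound of this kind is a single inequality, both
  for \<open>p = \<infinity>\<close> and for finite \<open>p\<close>, so the two kinds of exponent
  can be compared.\<close>

definition Lp_le :: "'a measure \<Rightarrow> ennreal \<Rightarrow> ('a \<Rightarrow> complex) \<Rightarrow> real \<Rightarrow> bool" where
  "Lp_le M p f C \<longleftrightarrow> f \<in> Lp_fun M p \<and> Lp_norm M p f \<le> C"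

lemma Lp_norm_nonneg: "0 \<le> Lp_norm M p f"
  by (simp add: Lp_norm_def)

lemma Lp_le_nonneg: "Lp_le M p f C \<Longrightarrow> 0 \<le> C"
  using Lp_norm_nonneg[of M p f] by (simp add: Lp_le_def)

lemma Lp_le_Lp_norm: "f \<in> Lp_fun M p \<Longrightarrow> Lp_le M p f (Lp_norm M p f)"
  by (simp add: Lp_le_def)

lemma Lp_le_measurable: "Lp_le M p f C \<Longrightarrow> f \<in> borel_measurable M"
  by (simp add: Lp_le_def Lp_fun_def)

lemma Lp_fun_measurable: "f \<in> Lp_fun M p \<Longrightarrow> f \<in> borel_measurable M"
  by (simp add: Lp_fun_def)

lemma enn2real_ge_1:
  fixes p :: ennreal
  assumes "1 \<le> p" "p \<noteq> \<infinity>"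
  shows "1 \<le> enn2real p"
  using assms by (cases p) (auto simp flip: ennreal_1)

lemma enn2real_inverse:
  fixes p :: ennreal
  assumes "1 \<le> p" "p \<noteq> \<infinity>"
  shows "enn2real (1 / p) = 1 / enn2real p"
  using assms by (cases p) (auto simp: divide_ennreal simp flip: ennreal_1)

lemma Lp_le_infinity_iff:
  assumes [measurable]: "f \<in> borel_measurable M" and C: "0 \<le> C"
  shows "Lp_le M top f C \<longleftrightarrow> (AE x in M. cmod (f x) \<le> C)"
proof
  assume L: "Lp_le M top f C"
  let ?s = "esssup M (\<lambda>x. ennreal (cmod (f x)))"
  have fin: "?s < \<infinity>" and le: "enn2real ?s \<le> C"
    using L by (auto simp: Lp_le_def Lp_fun_def Lp_norm_def)
  have "?s \<le> ennreal C"
    using fin le by (metis ennreal_enn2real ennreal_leI infinity_ennreal_def)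
  have "AE x in M. ennreal (cmod (f x)) \<le> ?s"
    by (rule esssup_AE)
  then show "AE x in M. cmod (f x) \<le> C"
  proof eventually_elim
    case (elim x)
    with \<open>?s \<le> ennreal C\<close> have "ennreal (cmod (f x)) \<le> ennreal C" by (rule order_trans[rotated])
    then show ?case using C by (simp add: ennreal_le_iff)
  qed
next
  assume "AE x in M. cmod (f x) \<le> C"
  then have "esssup M (\<lambda>x. ennreal (cmod (f x))) \<le> ennreal C"
    by (intro esssup_I) (auto simp: ennreal_leI)
  then show "Lp_le M top f C"
    using C enn2real_leI by (auto simp: Lp_le_def Lp_fun_def Lp_norm_def less_top[symmetric] top_unique)
qed

lemma Lp_le_finite_iff:
  assumes [measurable]: "f \<in> borel_measurable M" and C: "0 \<le> C" and p: "1 \<le> p" "p \<noteq> \<infinity>"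
  shows "Lp_le M p f C \<longleftrightarrow>
    (\<integral>\<^sup>+x. ennreal (cmod (f x) powr enn2real p) \<partial>M) \<le> ennreal (C powr enn2real p)"
proof -
  define r where "r = enn2real p"
  have r: "0 < r" using enn2real_ge_1[OF p] by (simp add: r_def)
  let ?I = "\<integral>\<^sup>+x. ennreal (cmod (f x) powr r) \<partial>M"
  show ?thesis
  proof
    assume "Lp_le M p f C"
    then have fin: "?I < \<infinity>" and le: "enn2real ?I powr (1 / r) \<le> C"
      using p by (auto simp: Lp_le_def Lp_fun_def Lp_norm_def r_def)
    have "enn2real ?I = (enn2real ?I powr (1 / r)) powr r"
      using r by (simp add: powr_powr)
    also have "\<dots> \<le> C powr r"
      using le r by (intro powr_mono2) auto
    finally have "ennreal (enn2real ?I) \<le> ennreal (C powr r)"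
      by (rule ennreal_leI)
    then show "(\<integral>\<^sup>+x. ennreal (cmod (f x) powr enn2real p) \<partial>M) \<le> ennreal (C powr enn2real p)"
      using fin by (metis ennreal_enn2real infinity_ennreal_def r_def)
  next
    assume "(\<integral>\<^sup>+x. ennreal (cmod (f x) powr enn2real p) \<partial>M) \<le> ennreal (C powr enn2real p)"
    then have I: "?I \<le> ennreal (C powr r)" by (simp add: r_def)
    then have "enn2real ?I \<le> C powr r" by (intro enn2real_leI) auto
    then have "enn2real ?I powr (1 / r) \<le> (C powr r) powr (1 / r)"
      using r by (intro powr_mono2) auto
    also have "\<dots> = C" using r C by (simp add: powr_powr)
    finally show "Lp_le M p f C"
      using I p by (auto simp: Lp_le_def Lp_fun_def Lp_norm_def r_def less_top[symmetric] top_unique)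
  qed
qed

text \<open>A function is determined, as far as membership and norm go, by the bounds that it satisfies;
  this reduces changes of measure to an equivalence of inequalities.\<close>

lemma Lp_fun_norm_eqI:
  assumes "\<And>C. 0 \<le> C \<Longrightarrow> Lp_le M p f C \<longleftrightarrow> Lp_le N q h C"
  shows "f \<in> Lp_fun M p \<longleftrightarrow> h \<in> Lp_fun N q"
    and "f \<in> Lp_fun M p \<Longrightarrow> Lp_norm M p f = Lp_norm N q h"
proof -
  have eq: "Lp_le M p f C \<longleftrightarrow> Lp_le N q h C" for C
    using assms Lp_le_nonneg by metis
  then show *: "f \<in> Lp_fun M p \<longleftrightarrow> h \<in> Lp_fun N q"
    by (metis Lp_le_Lp_norm Lp_le_def)
  assume "f \<in> Lp_fun M p"
  then show "Lp_norm M p f = Lp_norm N q h"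
    using eq * by (metis Lp_le_Lp_norm Lp_le_def order_antisym)
qed

lemma Lp_le_mono:
  assumes p: "1 \<le> p" and h: "Lp_le M p h C" and f[measurable]: "f \<in> borel_measurable M"
    and K: "0 \<le> K" and le: "AE x in M. cmod (f x) \<le> K * cmod (h x)"
  shows "Lp_le M p f (K * C)"
proof -
  have [measurable]: "h \<in> borel_measurable M" using h by (simp add: Lp_le_def Lp_fun_def)
  have C: "0 \<le> C" using h by (rule Lp_le_nonneg)
  show ?thesis
  proof (cases "p = \<infinity>")
    case True
    have "AE x in M. cmod (h x) \<le> C"
      using h C by (simp add: True Lp_le_infinity_iff)
    with le have "AE x in M. cmod (f x) \<le> K * C"
      by eventually_elim (metis K mult_left_mono order_trans)
    then show ?thesis using K C by (simp add: True Lp_le_infinity_iff)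
  next
    case False
    define r where "r = enn2real p"
    have r: "0 < r" using enn2real_ge_1[OF p False] by (simp add: r_def)
    have "(\<integral>\<^sup>+x. ennreal (cmod (f x) powr r) \<partial>M) \<le> (\<integral>\<^sup>+x. ennreal (K powr r) * ennreal (cmod (h x) powr r) \<partial>M)"
    proof (rule nn_integral_mono_AE)
      show "AE x in M. ennreal (cmod (f x) powr r) \<le> ennreal (K powr r) * ennreal (cmod (h x) powr r)"
        using le
      proof eventually_elim
        case (elim x)
        have "cmod (f x) powr r \<le> (K * cmod (h x)) powr r"
          using elim r by (intro powr_mono2) auto
        then show ?case
          using K by (simp add: powr_mult ennreal_leI flip: ennreal_mult)
      qed
    qed
    also have "\<dots> = ennreal (K powr r) * (\<integral>\<^sup>+x. ennreal (cmod (h x) powr r) \<partial>M)"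
      by (rule nn_integral_cmult) simp
    also have "\<dots> \<le> ennreal (K powr r) * ennreal (C powr r)"
      using h C p False by (intro mult_left_mono) (auto simp: Lp_le_finite_iff r_def)
    also have "\<dots> = ennreal ((K * C) powr r)"
      using K C by (simp add: powr_mult flip: ennreal_mult)
    finally show ?thesis using K C p False by (simp add: Lp_le_finite_iff r_def)
  qed
qed

text \<open>\<open>|f + h|\<close> is at most twice the maximum of \<open>|f|\<close> and
  \<open>|h|\<close>, and the \<open>p\<close>-th power of a maximum is at most the sum of the
  \<open>p\<close>-th powers.\<close>

lemma Lp_fun_add:
  assumes p: "1 \<le> p" and f: "f \<in> Lp_fun M p" and h: "h \<in> Lp_fun M p"
  shows "(\<lambda>x. f x + h x) \<in> Lp_fun M p"
proof -
  have [measurable]: "f \<in> borel_measurable M" "h \<in> borel_measurable M"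
    using f h by (auto dest: Lp_fun_measurable)
  show ?thesis
  proof (cases "p = \<infinity>")
    case True
    have "Lp_le M top f (Lp_norm M top f)" "Lp_le M top h (Lp_norm M top h)"
      using f h True by (auto intro: Lp_le_Lp_norm)
    then have "AE x in M. cmod (f x) \<le> Lp_norm M top f" "AE x in M. cmod (h x) \<le> Lp_norm M top h"
      by (auto simp: Lp_le_infinity_iff Lp_norm_nonneg)
    then have "AE x in M. cmod (f x + h x) \<le> Lp_norm M top f + Lp_norm M top h"
      by eventually_elim (meson add_mono norm_triangle_ineq order_trans)
    then have "Lp_le M top (\<lambda>x. f x + h x) (Lp_norm M top f + Lp_norm M top h)"
      by (simp add: Lp_le_infinity_iff Lp_norm_nonneg)
    then show ?thesis by (simp add: True Lp_le_def)
  next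
    case False
    define r where "r = enn2real p"
    have r: "0 < r" using enn2real_ge_1[OF p False] by (simp add: r_def)
    define m where "m = (\<lambda>x. complex_of_real (max (cmod (f x)) (cmod (h x))))"
    have [measurable]: "m \<in> borel_measurable M" unfolding m_def by measurable
    have "(\<integral>\<^sup>+x. ennreal (cmod (m x) powr r) \<partial>M)
        \<le> (\<integral>\<^sup>+x. ennreal (cmod (f x) powr r) + ennreal (cmod (h x) powr r) \<partial>M)"
      by (intro nn_integral_mono) (auto simp: m_def max_def)
    also have "\<dots> = (\<integral>\<^sup>+x. ennreal (cmod (f x) powr r) \<partial>M) + (\<integral>\<^sup>+x. ennreal (cmod (h x) powr r) \<partial>M)"
      by (rule nn_integral_add) auto
    also have "\<dots> < \<infinity>"
      using f h False by (auto simp: Lp_fun_def r_def)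
    finally have "m \<in> Lp_fun M p" using False by (simp add: Lp_fun_def r_def)
    have "Lp_le M p (\<lambda>x. f x + h x) (2 * Lp_norm M p m)"
    proof (rule Lp_le_mono[OF p Lp_le_Lp_norm[OF \<open>m \<in> Lp_fun M p\<close>]])
      have "cmod (f x + h x) \<le> 2 * cmod (m x)" for x
        using norm_triangle_ineq[of "f x" "h x"] by (auto simp: m_def)
      then show "AE x in M. cmod (f x + h x) \<le> 2 * cmod (m x)" by simp
    qed auto
    then show ?thesis by (simp add: Lp_le_def)
  qed
qed

lemma Lp_fun_scale:
  assumes "1 \<le> p" and f: "f \<in> Lp_fun M p"
  shows "(\<lambda>x. a * f x) \<in> Lp_fun M p"
proof -
  have [measurable]: "f \<in> borel_measurable M" using f by (rule Lp_fun_measurable)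
  have "Lp_le M p (\<lambda>x. a * f x) (cmod a * Lp_norm M p f)"
    by (rule Lp_le_mono[OF assms(1) Lp_le_Lp_norm[OF f]]) (auto simp: norm_mult)
  then show ?thesis by (simp add: Lp_le_def)
qed

section \<open>Change of measure\<close>

text \<open>For finite \<open>q\<close>, \<open>|h|\<^sup>q\<close> times the density is the
  \<open>q\<close>-th power of \<open>|h|\<close> times the \<open>q\<close>-th root of the
  density. For \<open>q = \<infinity>\<close> the exponent is \<open>0\<close>, and the convention
  \<open>0 powr 0 = 0\<close> turns the factor into the indicator of the set where the density is
  positive, which is the right one: the weighted measure does not see the values of
  \<open>h\<close> elsewhere.\<close>

lemma Lp_le_density_iff:
  assumes q: "1 \<le> q" and [measurable]: "\<rho> \<in> borel_measurable M" and \<rho>: "AE x in M. 0 \<le> \<rho> x"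
    and h[measurable]: "h \<in> borel_measurable M" and C: "0 \<le> C"
  shows "Lp_le (density M (\<lambda>x. ennreal (\<rho> x))) q h C \<longleftrightarrow>
    Lp_le M q (\<lambda>x. complex_of_real (\<rho> x powr enn2real (1 / q)) * h x) C"
proof (cases "q = \<infinity>")
  case True
  have "Lp_le (density M (\<lambda>x. ennreal (\<rho> x))) q h C \<longleftrightarrow> (AE x in M. 0 < \<rho> x \<longrightarrow> cmod (h x) \<le> C)"
    using C by (simp add: True Lp_le_infinity_iff AE_density)
  also have "\<dots> \<longleftrightarrow> (AE x in M. cmod (complex_of_real (\<rho> x powr enn2real (1 / q)) * h x) \<le> C)"
    (is "?L \<longleftrightarrow> ?R")
  proof
    assume ?L with \<rho> show ?R
      by eventually_elim (use C in \<open>auto simp: norm_mult True\<close>)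
  next
    assume ?R with \<rho> show ?L
      by eventually_elim (auto simp: norm_mult True)
  qed
  also have "\<dots> \<longleftrightarrow> Lp_le M q (\<lambda>x. complex_of_real (\<rho> x powr enn2real (1 / q)) * h x) C"
    unfolding True infinity_ennreal_def by (subst Lp_le_infinity_iff) (auto simp: C)
  finally show ?thesis .
next
  case False
  define r where "r = enn2real q"
  have r: "0 < r" using enn2real_ge_1[OF q False] by (simp add: r_def)
  have q1: "enn2real (1 / q) = 1 / r"
    unfolding r_def by (rule enn2real_inverse[OF q False])
  have "(\<integral>\<^sup>+x. ennreal (cmod (h x) powr r) \<partial>density M (\<lambda>x. ennreal (\<rho> x)))
      = (\<integral>\<^sup>+x. ennreal (\<rho> x) * ennreal (cmod (h x) powr r) \<partial>M)"
    by (rule nn_integral_density) auto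
  also have "\<dots> = (\<integral>\<^sup>+x. ennreal (cmod (complex_of_real (\<rho> x powr (1 / r)) * h x) powr r) \<partial>M)"
  proof (rule nn_integral_cong_AE)
    show "AE x in M. ennreal (\<rho> x) * ennreal (cmod (h x) powr r)
        = ennreal (cmod (complex_of_real (\<rho> x powr (1 / r)) * h x) powr r)"
      using \<rho>
    proof eventually_elim
      case (elim x)
      then show ?case using r
        by (simp add: norm_mult powr_mult powr_powr ennreal_mult)
    qed
  qed
  finally have eq: "(\<integral>\<^sup>+x. ennreal (cmod (h x) powr r) \<partial>density M (\<lambda>x. ennreal (\<rho> x))) =
    (\<integral>\<^sup>+x. ennreal (cmod (complex_of_real (\<rho> x powr (1 / r)) * h x) powr r) \<partial>M)" .
  have "Lp_le (density M (\<lambda>x. ennreal (\<rho> x))) q h C \<longleftrightarrow>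
      (\<integral>\<^sup>+x. ennreal (cmod (h x) powr r) \<partial>density M (\<lambda>x. ennreal (\<rho> x))) \<le> ennreal (C powr r)"
    unfolding r_def by (rule Lp_le_finite_iff) (use q C False in auto)
  also have "\<dots> \<longleftrightarrow> Lp_le M q (\<lambda>x. complex_of_real (\<rho> x powr enn2real (1 / q)) * h x) C"
    unfolding eq q1 by (subst Lp_le_finite_iff) (use q C False in \<open>auto simp: r_def\<close>)
  finally show ?thesis .
qed

lemma Lp_le_restrict_iff:
  assumes p: "1 \<le> p" and A[measurable]: "A \<in> sets M" and f: "f \<in> borel_measurable M"
    and zero: "AE x in M. x \<notin> A \<longrightarrow> f x = 0" and C: "0 \<le> C"
  shows "Lp_le (restrict_space M A) p f C \<longleftrightarrow> Lp_le M p f C"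
proof -
  have fA: "f \<in> borel_measurable (restrict_space M A)"
    using f by (rule measurable_restrict_space1)
  note [measurable] = f
  show ?thesis
  proof (cases "p = \<infinity>")
    case True
    have "Lp_le (restrict_space M A) p f C \<longleftrightarrow> (AE x in M. x \<in> A \<longrightarrow> cmod (f x) \<le> C)"
      using fA C by (simp add: True Lp_le_infinity_iff AE_restrict_space_iff)
    also have "\<dots> \<longleftrightarrow> (AE x in M. cmod (f x) \<le> C)"
      (is "?L \<longleftrightarrow> ?R")
    proof
      assume ?L with zero show ?R by eventually_elim (use C in auto)
    next
      assume ?R then show ?L by eventually_elim auto
    qed
    finally show ?thesis using C by (simp add: True Lp_le_infinity_iff)
  next
    case False
    have "(\<integral>\<^sup>+x. ennreal (cmod (f x) powr enn2real p) \<partial>restrict_space M A)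
        = (\<integral>\<^sup>+x. ennreal (cmod (f x) powr enn2real p) * indicator A x \<partial>M)"
      by (rule nn_integral_restrict_space) auto
    also have "\<dots> = (\<integral>\<^sup>+x. ennreal (cmod (f x) powr enn2real p) \<partial>M)"
      by (rule nn_integral_cong_AE) (use zero in eventually_elim, auto split: split_indicator)
    finally show ?thesis using fA C p False by (simp add: Lp_le_finite_iff)
  qed
qed

section \<open>Multiplication operators on classes\<close>

text \<open>The condition for multiplication by \<open>g\<close> to respect almost everywhere equality when
  the codomain carries a measure that may charge null sets of the domain.\<close>

definition null_compatible :: "'a measure \<Rightarrow> 'a measure \<Rightarrow> ('a \<Rightarrow> complex) \<Rightarrow> bool" where
  "null_compatible M N g \<longleftrightarrow> (\<forall>A\<in>null_sets M. AE x in N. x \<in> A \<longrightarrow> g x = 0)"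

lemma null_compatibleD:
  assumes "null_compatible M N g" "AE x in M. f x = h x" and "sets N = sets M"
  shows "AE x in N. g x * f x = g x * h x"
proof -
  obtain A where A: "\<And>x. x \<in> space M - A \<Longrightarrow> f x = h x" "A \<in> null_sets M"
    by (rule AE_E3[OF assms(2)]) (rule that, auto)
  have sp: "space N = space M" using assms(3) by (rule sets_eq_imp_space_eq)
  have "AE x in N. x \<in> A \<longrightarrow> g x = 0"
    using assms(1) A by (simp add: null_compatible_def)
  then show ?thesis
    using AE_space[of N] by eventually_elim (use A sp in auto)
qed

lemma ae_eq_class_mem: "f \<in> borel_measurable M \<Longrightarrow> f \<in> ae_eq M `` {f}"
  by (simp add: ae_eq_def)

lemma carrier_Lp: "carrier (Lp M p) = (\<lambda>f. ae_eq M `` {f}) ` Lp_fun M p"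
  by (auto simp: Lp_def quotient_def)

lemma class_in_carrier: "f \<in> Lp_fun M p \<Longrightarrow> ae_eq M `` {f} \<in> carrier (Lp M p)"
  by (simp add: carrier_Lp)

lemma class_in_carrierD:
  assumes "ae_eq M `` {f} \<in> carrier (Lp M p)" "f \<in> borel_measurable M"
  shows "f \<in> Lp_fun M p"
proof -
  obtain h where h: "h \<in> Lp_fun M p" "ae_eq M `` {f} = ae_eq M `` {h}"
    using assms(1) by (auto simp: carrier_Lp)
  then have "(h, f) \<in> ae_eq M" using ae_eq_class_mem[OF assms(2)] by auto
  then show ?thesis using h(1) Lp_fun_cong by blast
qed

lemma mult_op_class:
  assumes "null_compatible M N g" and s: "sets N = sets M" and g: "g \<in> borel_measurable M"
    and f: "f \<in> borel_measurable M"
  shows "mult_op N g (ae_eq M `` {f}) = ae_eq N `` {\<lambda>x. g x * f x}"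
proof -
  have ms: "borel_measurable N = borel_measurable M"
    using s by (intro measurable_cong_sets) auto
  have eq: "ae_eq N `` {\<lambda>x. g x * h x} = ae_eq N `` {\<lambda>x. g x * f x}" if "h \<in> ae_eq M `` {f}" for h
  proof -
    have h: "h \<in> borel_measurable M" and "AE x in M. f x = h x"
      using that by (simp_all add: ae_eq_def)
    from this(2) have hf: "AE x in M. h x = f x" by eventually_elim simp
    have "(\<lambda>x. g x * h x, \<lambda>x. g x * f x) \<in> ae_eq N"
      using null_compatibleD[OF assms(1) hf s] g f h by (simp add: ae_eq_def ms)
    then show ?thesis by (rule equiv_class_eq[OF equiv_ae_eq])
  qed
  have "mult_op N g (ae_eq M `` {f}) = (\<Union>h\<in>ae_eq M `` {f}. ae_eq N `` {\<lambda>x. g x * f x})"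
    unfolding mult_op_def by (rule SUP_cong[OF refl eq])
  also have "\<dots> = ae_eq N `` {\<lambda>x. g x * f x}"
    using ae_eq_class_mem[OF f] by (subst UN_constant) (auto simp del: Image_singleton_iff)
  finally show ?thesis .
qed

text \<open>Linearity comes for free once the operator is well defined on classes. For a null set
  \<open>A\<close> the functions \<open>0\<close> and \<open>indicator A\<close> represent the
  same class, so well-definedness forces \<open>g\<close> to vanish almost everywhere on
  \<open>A\<close> for the measure of the codomain.\<close>

lemma bounded_mult_op_iff:
  assumes s: "sets N = sets M" and g[measurable]: "g \<in> borel_measurable M" and p: "1 \<le> p" and q: "1 \<le> q"
  shows "bounded_operator (Lp M p) (Lp N q) (mult_op N g) \<longleftrightarrow>
    null_compatible M N g \<and>
    (\<exists>K\<ge>0. \<forall>f\<in>Lp_fun M p. Lp_le N q (\<lambda>x. g x * f x) (K * Lp_norm M p f))"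
    (is "?L \<longleftrightarrow> ?C \<and> ?B")
proof -
  have ms: "borel_measurable N = borel_measurable M"
    using s by (intro measurable_cong_sets) auto
  have C: ?C if L: ?L
    unfolding null_compatible_def
  proof
    fix A assume A: "A \<in> null_sets M"
    define z where "z = (\<lambda>x::'a. 0::complex)"
    define e where "e = (\<lambda>x. indicator A x :: complex)"
    have AE: "AE x in M. z x = e x"
      using AE_not_in[OF A] by eventually_elim (auto simp: z_def e_def)
    have [measurable]: "z \<in> borel_measurable M" "e \<in> borel_measurable M"
      using A by (auto simp: z_def e_def)
    have z: "z \<in> Lp_fun M p"
    proof (cases "p = \<infinity>")
      case True
      have "Lp_le M top z 0" by (subst Lp_le_infinity_iff) (auto simp: z_def)
      then show ?thesis by (simp add: True Lp_le_def)
    qed (auto simp: Lp_fun_def z_def)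
    have "(z, e) \<in> ae_eq M" using AE by (simp add: ae_eq_def)
    then have e: "e \<in> Lp_fun M p" using z Lp_fun_cong by blast
    have "\<forall>F\<in>carrier (Lp M p). mult_op N g F \<in> carrier (Lp N q)"
      using L by (simp add: bounded_operator_def)
    then have "AE x in N. g x * z x = g x * e x"
      using z e AE by (subst (asm) mult_op_carrier_iff[OF s g]) blast
    then show "AE x in N. x \<in> A \<longrightarrow> g x = 0"
      by eventually_elim (auto simp: z_def e_def)
  qed
  have "?L \<longleftrightarrow> ?B" if C: ?C
  proof -
    have cl: "mult_op N g (ae_eq M `` {f}) = ae_eq N `` {\<lambda>x. g x * f x}"
      if "f \<in> borel_measurable M" for f using mult_op_class[OF C s g that] .
    have pm: "(\<lambda>x. g x * f x) \<in> borel_measurable N" if "f \<in> borel_measurable M" for f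
      using that by (simp add: ms)
    show ?thesis
    proof
      assume L: ?L
      obtain K where K: "\<forall>F\<in>carrier (Lp M p). nrm (Lp N q) (mult_op N g F) \<le> K * nrm (Lp M p) F"
        using L by (auto simp: bounded_operator_def)
      show ?B
      \<comment> \<open>\<open>K\<close> may be negative if all norms vanish.\<close>
      proof (intro exI[of _ "max K 0"] conjI ballI)
        fix f assume f: "f \<in> Lp_fun M p"
        then have fm: "f \<in> borel_measurable M" by (rule Lp_fun_measurable)
        have "mult_op N g (ae_eq M `` {f}) \<in> carrier (Lp N q)"
          using L class_in_carrier[OF f] by (auto simp: bounded_operator_def)
        then have 1: "(\<lambda>x. g x * f x) \<in> Lp_fun N q"
          using cl[OF fm] pm[OF fm] by (auto intro: class_in_carrierD)
        have "nrm (Lp N q) (mult_op N g (ae_eq M `` {f})) \<le> K * nrm (Lp M p) (ae_eq M `` {f})"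
          using K class_in_carrier[OF f] by blast
        then have "Lp_norm N q (\<lambda>x. g x * f x) \<le> K * Lp_norm M p f"
          by (simp add: cl fm pm nrm_Lp_class)
        also have "\<dots> \<le> max K 0 * Lp_norm M p f"
          by (intro mult_right_mono) (auto simp: Lp_norm_nonneg)
        finally show "Lp_le N q (\<lambda>x. g x * f x) (max K 0 * Lp_norm M p f)"
          using 1 by (simp add: Lp_le_def)
      qed auto
    next
      assume ?B
      then obtain K where K: "\<And>f. f \<in> Lp_fun M p \<Longrightarrow> Lp_le N q (\<lambda>x. g x * f x) (K * Lp_norm M p f)"
        by auto
      show ?L
        unfolding bounded_operator_def carrier_Lp ball_simps
      proof (intro conjI ballI allI exI[of _ K])
        fix f assume f: "f \<in> Lp_fun M p"
        then have fm: "f \<in> borel_measurable M" by (rule Lp_fun_measurable)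
        show "mult_op N g (ae_eq M `` {f}) \<in> (\<lambda>f. ae_eq N `` {f}) ` Lp_fun N q"
          using K[OF f] by (auto simp: cl fm Lp_le_def)
        show "nrm (Lp N q) (mult_op N g (ae_eq M `` {f})) \<le> K * nrm (Lp M p) (ae_eq M `` {f})"
          using K[OF f] by (auto simp: cl fm pm nrm_Lp_class Lp_le_def)
        show "mult_op N g (scale (Lp M p) a (ae_eq M `` {f})) = scale (Lp N q) a (mult_op N g (ae_eq M `` {f}))" for a
          using cl[of "\<lambda>x. a * f x"] fm by (simp add: scale_Lp_class pm cl mult.left_commute)
        fix h assume h: "h \<in> Lp_fun M p"
        then have hm: "h \<in> borel_measurable M" by (rule Lp_fun_measurable)
        show "mult_op N g (add (Lp M p) (ae_eq M `` {f}) (ae_eq M `` {h})) =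
           add (Lp N q) (mult_op N g (ae_eq M `` {f})) (mult_op N g (ae_eq M `` {h}))"
          using cl[of "\<lambda>x. f x + h x"] fm hm by (simp add: add_Lp_class pm cl distrib_left)
      qed
    qed
  qed
  with C show ?thesis by blast
qed

lemma topologically_injective_mult_op_iff:
  assumes s: "sets N = sets M" and g: "g \<in> borel_measurable M" and p: "1 \<le> p" "1 \<le> q"
    and b: "bounded_operator (Lp M p) (Lp N q) (mult_op N g)"
  shows "topologically_injective (Lp M p) (Lp N q) (mult_op N g) \<longleftrightarrow>
    (\<exists>c>0. \<forall>f\<in>Lp_fun M p. c * Lp_norm M p f \<le> Lp_norm N q (\<lambda>x. g x * f x))"
proof -
  have C: "null_compatible M N g" using b bounded_mult_op_iff[OF s g p] by blast
  have ms: "borel_measurable N = borel_measurable M"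
    using s by (intro measurable_cong_sets) auto
  have nrms: "nrm (Lp N q) (mult_op N g (ae_eq M `` {f})) = Lp_norm N q (\<lambda>x. g x * f x)"
    "nrm (Lp M p) (ae_eq M `` {f}) = Lp_norm M p f" if "f \<in> Lp_fun M p" for f
    using Lp_fun_measurable[OF that] g by (auto simp: mult_op_class[OF C s g] nrm_Lp_class ms)
  have "(\<forall>F\<in>carrier (Lp M p). nrm (Lp N q) (mult_op N g F) \<ge> c * nrm (Lp M p) F) \<longleftrightarrow>
    (\<forall>f\<in>Lp_fun M p. c * Lp_norm M p f \<le> Lp_norm N q (\<lambda>x. g x * f x))" for c
    unfolding carrier_Lp ball_simps by (rule ball_cong) (simp_all only: nrms)
  then show ?thesis
    unfolding topologically_injective_def using b by simp
qed

text \<open>An inverse map such as \<^const>\<open>inv_into\<close> is specified on the carrier only, so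
  replacing it by an explicit formula requires that the vector space operations do not leave the
  carrier.\<close>

lemma bounded_operator_cong:
  assumes b: "bounded_operator X Y T" and eq: "\<And>x. x \<in> carrier X \<Longrightarrow> S x = T x"
    and "\<And>x y. x \<in> carrier X \<Longrightarrow> y \<in> carrier X \<Longrightarrow> add X x y \<in> carrier X"
    and "\<And>a x. x \<in> carrier X \<Longrightarrow> scale X a x \<in> carrier X"
  shows "bounded_operator X Y S"
proof -
  obtain K where K: "\<forall>x\<in>carrier X. nrm Y (T x) \<le> K * nrm X x"
    using b unfolding bounded_operator_def by blast
  show ?thesis
    unfolding bounded_operator_def
  proof (intro conjI ballI allI exI[of _ K])
    fix x assume x: "x \<in> carrier X"
    show "S x \<in> carrier Y" "nrm Y (S x) \<le> K * nrm X x"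
      using b K x unfolding bounded_operator_def eq[OF x] by blast+
    show "S (scale X a x) = scale Y a (S x)" for a
      using b x unfolding bounded_operator_def eq[OF x] eq[OF assms(4)[OF x]] by blast
    fix y assume y: "y \<in> carrier X"
    show "S (add X x y) = add Y (S x) (S y)"
      using b x y unfolding bounded_operator_def eq[OF x] eq[OF y] eq[OF assms(3)[OF x y]] by blast
  qed
qed

lemma Lp_add_closed:
  assumes "1 \<le> p" "F \<in> carrier (Lp M p)" "H \<in> carrier (Lp M p)"
  shows "add (Lp M p) F H \<in> carrier (Lp M p)"
  using assms by (auto simp: carrier_Lp add_Lp_class Lp_fun_measurable Lp_fun_add)

lemma Lp_scale_closed:
  assumes "1 \<le> p" "F \<in> carrier (Lp M p)"
  shows "scale (Lp M p) a F \<in> carrier (Lp M p)"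
  using assms by (auto simp: carrier_Lp scale_Lp_class Lp_fun_measurable Lp_fun_scale)

text \<open>The inverse is again a multiplication operator, so its boundedness is another estimate on
  functions.\<close>

lemma isomorphism_mult_op:
  assumes s: "sets N = sets M" and g: "g \<in> borel_measurable M" and k: "k \<in> borel_measurable M"
    and p: "1 \<le> p" "1 \<le> q"
    and bg: "bounded_operator (Lp M p) (Lp N q) (mult_op N g)"
    and bk: "bounded_operator (Lp N q) (Lp M p) (mult_op M k)"
    and M1: "AE x in M. k x * g x = 1" and N1: "AE x in N. g x * k x = 1"
  shows "isomorphism (Lp M p) (Lp N q) (mult_op N g)"
proof -
  have ms: "borel_measurable N = borel_measurable M"
    using s by (intro measurable_cong_sets) auto
  note [measurable] = g k
  have kN: "k \<in> borel_measurable N" by (simp add: ms)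
  have Cg: "null_compatible M N g" using bg bounded_mult_op_iff[OF s g p] by blast
  have Ck: "null_compatible N M k" using bk bounded_mult_op_iff[OF s[symmetric] kN p(2,1)] by blast
  have kg: "mult_op M k (mult_op N g F) = F" if F: "F \<in> carrier (Lp M p)" for F
  proof -
    obtain f where f: "f \<in> Lp_fun M p" "F = ae_eq M `` {f}" using F by (auto simp: carrier_Lp)
    have [measurable]: "f \<in> borel_measurable M" using f by (simp add: Lp_fun_measurable)
    have "mult_op M k (mult_op N g F) = ae_eq M `` {\<lambda>x. k x * (g x * f x)}"
      by (simp add: f mult_op_class[OF Cg s g] mult_op_class[OF Ck s[symmetric] kN] ms)
    also have "\<dots> = F"
      unfolding f(2)
    proof (rule equiv_class_eq[OF equiv_ae_eq])
      have "AE x in M. k x * (g x * f x) = f x"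
        using M1 by eventually_elim (simp flip: mult.assoc)
      then show "(\<lambda>x. k x * (g x * f x), f) \<in> ae_eq M" by (simp add: ae_eq_def)
    qed
    finally show ?thesis .
  qed
  have gk: "mult_op N g (mult_op M k H) = H" if H: "H \<in> carrier (Lp N q)" for H
  proof -
    obtain f where f: "f \<in> Lp_fun N q" "H = ae_eq N `` {f}" using H by (auto simp: carrier_Lp)
    have [measurable]: "f \<in> borel_measurable M" using f by (simp add: Lp_fun_measurable flip: ms)
    have "mult_op N g (mult_op M k H) = ae_eq N `` {\<lambda>x. g x * (k x * f x)}"
      by (simp add: f mult_op_class[OF Cg s g] mult_op_class[OF Ck s[symmetric] kN] ms)
    also have "\<dots> = H"
      unfolding f(2)
    proof (rule equiv_class_eq[OF equiv_ae_eq])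
      have "AE x in N. g x * (k x * f x) = f x"
        using N1 by eventually_elim (simp flip: mult.assoc)
      then show "(\<lambda>x. g x * (k x * f x), f) \<in> ae_eq N" by (simp add: ae_eq_def ms)
    qed
    finally show ?thesis .
  qed
  have mg: "mult_op N g F \<in> carrier (Lp N q)" if "F \<in> carrier (Lp M p)" for F
    using bg that by (auto simp: bounded_operator_def)
  have mk: "mult_op M k F \<in> carrier (Lp M p)" if "F \<in> carrier (Lp N q)" for F
    using bk that by (auto simp: bounded_operator_def)
  have bij: "bij_betw (mult_op N g) (carrier (Lp M p)) (carrier (Lp N q))"
    by (rule bij_betwI[where g = "mult_op M k"]) (use kg gk mg mk in auto)
  have "bounded_operator (Lp N q) (Lp M p) (inv_into (carrier (Lp M p)) (mult_op N g))"
  proof (rule bounded_operator_cong[OF bk])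
    fix H assume H: "H \<in> carrier (Lp N q)"
    show "inv_into (carrier (Lp M p)) (mult_op N g) H = mult_op M k H"
      by (rule inv_into_f_eq) (use bij gk mk H in \<open>auto simp: bij_betw_def\<close>)
  qed (use p in \<open>auto intro: Lp_add_closed Lp_scale_closed\<close>)
  with bg bij show ?thesis by (simp add: isomorphism_def)
qed

lemma isomorphism_imp_topologically_injective:
  assumes iso: "isomorphism X Y T" and pos: "\<And>y. y \<in> carrier Y \<Longrightarrow> 0 \<le> nrm Y y"
  shows "topologically_injective X Y T"
proof -
  have b: "bounded_operator X Y T" and bij: "bij_betw T (carrier X) (carrier Y)"
    and bi: "bounded_operator Y X (inv_into (carrier X) T)"
    using iso by (auto simp: isomorphism_def)
  obtain K where K: "\<forall>y\<in>carrier Y. nrm X (inv_into (carrier X) T y) \<le> K * nrm Y y"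
    using bi by (auto simp: bounded_operator_def)
  define k where "k = max K 1"
  have k: "0 < k" "K \<le> k" by (auto simp: k_def)
  have "1 / k * nrm X x \<le> nrm Y (T x)" if x: "x \<in> carrier X" for x
  proof -
    have Tx: "T x \<in> carrier Y" using bij x by (auto simp: bij_betw_def)
    have "nrm X x = nrm X (inv_into (carrier X) T (T x))"
      using bij x by (simp add: bij_betw_def)
    also have "\<dots> \<le> K * nrm Y (T x)" using K Tx by blast
    also have "\<dots> \<le> k * nrm Y (T x)" using pos[OF Tx] k(2) by (intro mult_right_mono)
    finally have "nrm X x / k \<le> nrm Y (T x)" using k(1) by (simp add: pos_divide_le_eq mult.commute)
    then show ?thesis by simp
  qed
  with b k(1) show ?thesis
    unfolding topologically_injective_def by (intro conjI exI[of _ "1 / k"]) auto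
qed

section \<open>Disjoint blocks\<close>

lemma enn2real_reciprocal_inject:
  fixes p q :: ennreal
  assumes p: "1 \<le> p" and q: "1 \<le> q" and eq: "enn2real (1 / p) = enn2real (1 / q)"
  shows "p = q"
proof (cases "p = \<infinity> \<or> q = \<infinity>")
  case True
  with p q eq show ?thesis
    using enn2real_ge_1[OF p] enn2real_ge_1[OF q] enn2real_inverse[OF p] enn2real_inverse[OF q]
    by (cases "p = \<infinity>"; cases "q = \<infinity>") auto
next
  case False
  then have "enn2real p = enn2real q"
    using eq enn2real_inverse[OF p] enn2real_inverse[OF q] by simp
  then show ?thesis
    using False by (metis ennreal_enn2real_if infinity_ennreal_def)
qed

lemma Lp_indicator:
  assumes p: "1 \<le> p" and A[measurable]: "A \<in> sets M" and pos: "0 < emeasure M A" and fin: "emeasure M A < \<infinity>"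
    and a: "0 \<le> a"
  shows "(\<lambda>x. complex_of_real a * indicator A x) \<in> Lp_fun M p"
    and "Lp_norm M p (\<lambda>x. complex_of_real a * indicator A x) = a * measure M A powr enn2real (1 / p)"
proof -
  let ?f = "\<lambda>x. complex_of_real a * indicator A x"
  have m: "0 < measure M A" using pos fin by (simp add: measure_def enn2real_positive_iff)
  have em: "emeasure M A = ennreal (measure M A)" using fin by (intro emeasure_eq_ennreal_measure) auto
  have "Lp_le M p ?f C \<longleftrightarrow> a * measure M A powr enn2real (1 / p) \<le> C" if C: "0 \<le> C" for C
  proof (cases "p = \<infinity>")
    case True
    have "Lp_le M p ?f C \<longleftrightarrow> (AE x in M. x \<in> A \<longrightarrow> a \<le> C)"
    proof -
      have "Lp_le M p ?f C \<longleftrightarrow> (AE x in M. cmod (?f x) \<le> C)"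
        unfolding True infinity_ennreal_def by (rule Lp_le_infinity_iff) (use C in auto)
      also have "\<dots> \<longleftrightarrow> (AE x in M. x \<in> A \<longrightarrow> a \<le> C)"
        by (intro AE_cong) (use C a in \<open>auto split: split_indicator simp: norm_mult\<close>)
      finally show ?thesis .
    qed
    also have "\<dots> \<longleftrightarrow> a \<le> C"
    proof
      assume AE: "AE x in M. x \<in> A \<longrightarrow> a \<le> C"
      show "a \<le> C"
      proof (rule ccontr)
        assume "\<not> a \<le> C"
        with AE have "AE x in M. x \<notin> A" by simp
        then have "emeasure M A = 0" using A by (simp add: AE_iff_null_sets null_setsD1)
        with pos show False by simp
      qed
    qed auto
    finally show ?thesis using m True by simp
  next
    case False
    define r where "r = enn2real p"
    have r: "0 < r" using enn2real_ge_1[OF p False] by (simp add: r_def)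
    have "(\<integral>\<^sup>+x. ennreal (cmod (?f x) powr r) \<partial>M) = (\<integral>\<^sup>+x. ennreal (a powr r) * indicator A x \<partial>M)"
      by (intro nn_integral_cong) (auto split: split_indicator simp: a)
    also have "\<dots> = ennreal (a powr r * measure M A)"
      using em by (simp add: nn_integral_cmult ennreal_mult)
    finally have "Lp_le M p ?f C \<longleftrightarrow> a powr r * measure M A \<le> C powr r"
      using p False C by (simp add: Lp_le_finite_iff r_def)
    also have "a powr r * measure M A = (a * measure M A powr (1 / r)) powr r"
      using r m a by (simp add: powr_mult powr_powr)
    also have "\<dots> \<le> C powr r \<longleftrightarrow> a * measure M A powr (1 / r) \<le> C"
      using r a C by (metis m linorder_not_le mult_nonneg_nonneg powr_ge_zero powr_less_mono2 powr_mono2 less_eq_real_def)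
    finally show ?thesis using enn2real_inverse[OF p False] by (simp add: r_def)
  qed
  note le = this
  have nn: "0 \<le> a * measure M A powr enn2real (1 / p)" using a by simp
  show mem: "?f \<in> Lp_fun M p" using le[OF nn] by (simp add: Lp_le_def)
  show "Lp_norm M p ?f = a * measure M A powr enn2real (1 / p)"
    using le[OF nn] le[OF Lp_norm_nonneg, of M p ?f] mem by (simp add: Lp_le_def)
qed

text \<open>At each point at most one block is nonzero, so the \<open>r\<close>-th power of the modulus is
  additive over the blocks.\<close>

lemma nn_integral_blocks:
  assumes "finite \<A>" "disjoint \<A>" and sets: "\<A> \<subseteq> sets M" and [measurable]: "f \<in> borel_measurable M"
    and zero: "\<And>x. x \<in> space M \<Longrightarrow> x \<notin> \<Union>\<A> \<Longrightarrow> f x = 0"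
  shows "(\<integral>\<^sup>+x. ennreal (cmod (f x) powr r) \<partial>M) =
    (\<Sum>A\<in>\<A>. \<integral>\<^sup>+x. ennreal (cmod (f x * indicator A x) powr r) \<partial>M)"
proof -
  have df: "disjoint_family_on (\<lambda>A. A) \<A>"
    using \<open>disjoint \<A>\<close> by (auto simp: disjoint_family_on_def disjoint_def)
  have "(\<integral>\<^sup>+x. ennreal (cmod (f x) powr r) \<partial>M) =
    (\<integral>\<^sup>+x. (\<Sum>A\<in>\<A>. ennreal (cmod (f x * indicator A x) powr r)) \<partial>M)"
  proof (rule nn_integral_cong)
    fix x assume x: "x \<in> space M"
    have ind: "(indicator (\<Union>A\<in>\<A>. A) x :: ennreal) = (\<Sum>A\<in>\<A>. indicator A x)"
      by (rule indicator_UN_disjoint[OF \<open>finite \<A>\<close> df])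
    have "(\<Sum>A\<in>\<A>. ennreal (cmod (f x * indicator A x) powr r)) =
       (\<Sum>A\<in>\<A>. ennreal (cmod (f x) powr r) * indicator A x)"
      by (intro sum.cong) (auto split: split_indicator)
    also have "\<dots> = ennreal (cmod (f x) powr r) * indicator (\<Union>A\<in>\<A>. A) x"
      unfolding ind by (simp add: sum_distrib_left)
    also have "\<dots> = ennreal (cmod (f x) powr r)"
      using zero[OF x] by (auto split: split_indicator)
    finally show "ennreal (cmod (f x) powr r) = (\<Sum>A\<in>\<A>. ennreal (cmod (f x * indicator A x) powr r))" ..
  qed
  also have "\<dots> = (\<Sum>A\<in>\<A>. \<integral>\<^sup>+x. ennreal (cmod (f x * indicator A x) powr r) \<partial>M)"
    by (rule nn_integral_sum) (use sets in auto)
  finally show ?thesis .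
qed

text \<open>Disjoint blocks of norm at most \<open>C\<close> behave like a sequence in \<open>l_p\<close>:
  \<open>m\<close> of them add up to a norm of at most \<open>m powr (1 / p) * C\<close>. Together
  with the reverse estimate below this is how the exponent is read off from a norm.\<close>

lemma Lp_le_blocks:
  assumes p: "1 \<le> p" and \<A>: "finite \<A>" "\<A> \<noteq> {}" "disjoint \<A>" "\<A> \<subseteq> sets M"
    and [measurable]: "f \<in> borel_measurable M"
    and zero: "\<And>x. x \<in> space M \<Longrightarrow> x \<notin> \<Union>\<A> \<Longrightarrow> f x = 0"
    and le: "\<And>A. A \<in> \<A> \<Longrightarrow> Lp_le M p (\<lambda>x. f x * indicator A x) C"
  shows "Lp_le M p f (real (card \<A>) powr enn2real (1 / p) * C)"
proof -
  obtain A0 where "A0 \<in> \<A>" using \<A> by auto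
  then have C: "0 \<le> C" using le Lp_le_nonneg by blast
  have m: "0 < real (card \<A>)" using \<A> by (simp add: card_gt_0_iff)
  have meas[measurable]: "(\<lambda>x. f x * indicator A x) \<in> borel_measurable M" if "A \<in> \<A>" for A
    using that \<A> by auto
  show ?thesis
  proof (cases "p = \<infinity>")
    case True
    have "AE x in M. cmod (f x * indicator A x) \<le> C" if "A \<in> \<A>" for A
      using le[OF that] meas[OF that] C by (simp add: True Lp_le_infinity_iff del: norm_mult)
    then have "AE x in M. \<forall>A\<in>\<A>. cmod (f x * indicator A x) \<le> C"
      using \<A>(1) by (simp add: AE_finite_all)
    then have "AE x in M. cmod (f x) \<le> C"
      using AE_space
    proof eventually_elim
      case (elim x)
      show ?case
      proof (cases "x \<in> \<Union>\<A>")
        case True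
        then obtain A where "A \<in> \<A>" "x \<in> A" by auto
        with elim show ?thesis by force
      qed (use zero elim C in auto)
    qed
    then show ?thesis using C m by (simp add: True Lp_le_infinity_iff)
  next
    case False
    define r where "r = enn2real p"
    have r: "0 < r" using enn2real_ge_1[OF p False] by (simp add: r_def)
    have "(\<integral>\<^sup>+x. ennreal (cmod (f x) powr r) \<partial>M) =
      (\<Sum>A\<in>\<A>. \<integral>\<^sup>+x. ennreal (cmod (f x * indicator A x) powr r) \<partial>M)"
      by (rule nn_integral_blocks) (use \<A> zero in auto)
    also have "\<dots> \<le> (\<Sum>A\<in>\<A>. ennreal (C powr r))"
    proof (rule sum_mono)
      fix A assume "A \<in> \<A>"
      then show "(\<integral>\<^sup>+x. ennreal (cmod (f x * indicator A x) powr r) \<partial>M) \<le> ennreal (C powr r)"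
        using le[of A] Lp_le_finite_iff[OF meas[of A] C p False] by (simp only: r_def)
    qed
    also have "\<dots> = ennreal (real (card \<A>) * C powr r)"
      by (simp add: ennreal_mult ennreal_of_nat_eq_real_of_nat)
    also have "real (card \<A>) * C powr r = (real (card \<A>) powr (1 / r) * C) powr r"
      using r C by (simp add: powr_mult powr_powr)
    finally show ?thesis
      using p False C by (simp add: Lp_le_finite_iff enn2real_inverse r_def)
  qed
qed

lemma Lp_norm_blocks_ge:
  assumes p: "1 \<le> p" and \<A>: "finite \<A>" "\<A> \<noteq> {}" "disjoint \<A>" "\<A> \<subseteq> sets M"
    and f: "f \<in> Lp_fun M p"
    and zero: "\<And>x. x \<in> space M \<Longrightarrow> x \<notin> \<Union>\<A> \<Longrightarrow> f x = 0"
    and c: "0 \<le> c"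
    and le: "\<And>A. A \<in> \<A> \<Longrightarrow> c \<le> Lp_norm M p (\<lambda>x. f x * indicator A x)"
  shows "real (card \<A>) powr enn2real (1 / p) * c \<le> Lp_norm M p f"
proof -
  have [measurable]: "f \<in> borel_measurable M" using f by (rule Lp_fun_measurable)
  obtain A0 where A0: "A0 \<in> \<A>" using \<A> by auto
  have m: "0 < real (card \<A>)" using \<A> by (simp add: card_gt_0_iff)
  have meas[measurable]: "(\<lambda>x. f x * indicator A x) \<in> borel_measurable M" if "A \<in> \<A>" for A
    using that \<A> by auto
  have block: "Lp_le M p (\<lambda>x. f x * indicator A x) (1 * Lp_norm M p f)" if "A \<in> \<A>" for A
    by (rule Lp_le_mono[OF p Lp_le_Lp_norm[OF f] meas[OF that]]) (auto split: split_indicator)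
  show ?thesis
  proof (cases "p = \<infinity>")
    case True
    then show ?thesis using le[OF A0] block[OF A0] m by (simp add: Lp_le_def)
  next
    case False
    define r where "r = enn2real p"
    have r: "0 < r" using enn2real_ge_1[OF p False] by (simp add: r_def)
    have "ennreal (c powr r) \<le> (\<integral>\<^sup>+x. ennreal (cmod (f x * indicator A x) powr r) \<partial>M)" (is "_ \<le> ?I")
      if "A \<in> \<A>" for A
    proof -
      have fin: "?I < \<infinity>" using block[OF that] False by (simp add: Lp_le_def Lp_fun_def r_def)
      have "c \<le> enn2real ?I powr (1 / r)"
        using le[OF that] False by (simp add: Lp_norm_def r_def)
      then have "c powr r \<le> (enn2real ?I powr (1 / r)) powr r"
        using r c by (intro powr_mono2) auto
      also have "\<dots> = enn2real ?I" using r by (simp add: powr_powr)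
      finally have "ennreal (c powr r) \<le> ennreal (enn2real ?I)" by (rule ennreal_leI)
      also have "\<dots> = ?I" using fin by (metis ennreal_enn2real infinity_ennreal_def)
      finally show ?thesis .
    qed
    then have "(\<Sum>A\<in>\<A>. ennreal (c powr r)) \<le>
        (\<Sum>A\<in>\<A>. \<integral>\<^sup>+x. ennreal (cmod (f x * indicator A x) powr r) \<partial>M)"
      by (rule sum_mono)
    also have "\<dots> = (\<integral>\<^sup>+x. ennreal (cmod (f x) powr r) \<partial>M)"
      by (rule nn_integral_blocks[symmetric]) (use \<A> zero in auto)
    also have "\<dots> \<le> ennreal (Lp_norm M p f powr r)"
      using Lp_le_Lp_norm[OF f] p False by (simp add: Lp_le_finite_iff Lp_norm_nonneg r_def)
    finally have "ennreal (real (card \<A>) * c powr r) \<le> ennreal (Lp_norm M p f powr r)"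
      by (simp add: ennreal_mult ennreal_of_nat_eq_real_of_nat)
    then have "real (card \<A>) * c powr r \<le> Lp_norm M p f powr r"
      by (simp add: ennreal_le_iff)
    then have "(real (card \<A>) * c powr r) powr (1 / r) \<le> (Lp_norm M p f powr r) powr (1 / r)"
      using r by (intro powr_mono2) auto
    also have "\<dots> = Lp_norm M p f" using r by (simp add: powr_powr Lp_norm_nonneg)
    finally show ?thesis
      using r c p False by (simp add: enn2real_inverse powr_mult powr_powr r_def)
  qed
qed

text \<open>An operator that is bounded above and below makes the numbers \<open>m powr (1 / p)\<close> and
  \<open>m powr (1 / q)\<close> comparable for every number \<open>m\<close> of disjoint nonnull
  sets: let \<open>f\<close> be the sum of the indicators of the sets, each normalised in
  \<open>L_p\<close>. Then \<open>f\<close> has norm \<open>m powr (1 / p)\<close>; each block of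
  \<open>g * f\<close> has norm between \<open>c\<close> and \<open>K\<close>, so \<open>g *
  f\<close> has norm comparable to \<open>m powr (1 / q)\<close>. As the exponents differ,
  \<open>m\<close> is bounded.\<close>

lemma disjoint_family_bound:
  assumes s: "sets N = sets M" and p: "1 \<le> p" and q: "1 \<le> q" and pq: "p \<noteq> q"
    and g: "g \<in> borel_measurable M"
    and upper: "\<And>f. f \<in> Lp_fun M p \<Longrightarrow> Lp_le N q (\<lambda>x. g x * f x) (K * Lp_norm M p f)"
    and c: "0 < c" and lower: "\<And>f. f \<in> Lp_fun M p \<Longrightarrow> c * Lp_norm M p f \<le> Lp_norm N q (\<lambda>x. g x * f x)"
  shows "\<exists>n. \<forall>\<A>. finite \<A> \<and> disjoint \<A> \<and> (\<forall>A\<in>\<A>. A \<in> sets M \<and> 0 < emeasure M A \<and> emeasure M A < \<infinity>) \<longrightarrow> card \<A> \<le> n"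
proof -
  define s where "s = enn2real (1 / p)"
  define t where "t = enn2real (1 / q)"
  have st: "s \<noteq> t"
    using enn2real_reciprocal_inject[OF p q] pq by (auto simp: s_def t_def)
  define d where "d = \<bar>s - t\<bar>"
  have d: "0 < d" using st by (simp add: d_def)
  \<comment> \<open>The two comparisons give \<open>m powr d \<le> K / c\<close>, which is solved for \<open>m\<close>.\<close>
  define b where "b = (K / c) powr (1 / d)"
  have "real (card \<A>) \<le> b"
    if fin: "finite \<A>" and ne: "\<A> \<noteq> {}" and dj: "disjoint \<A>" and sm: "\<And>A. A \<in> \<A> \<Longrightarrow> A \<in> sets M"
      and pos: "\<And>A. A \<in> \<A> \<Longrightarrow> 0 < emeasure M A" and fi: "\<And>A. A \<in> \<A> \<Longrightarrow> emeasure M A < \<infinity>" for \<A>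
  proof -
    define m where "m = real (card \<A>)"
    have m: "0 < m" using fin ne by (simp add: m_def card_gt_0_iff)
    define a where "a A = 1 / measure M A powr s" for A
    have a: "0 \<le> a A" for A by (simp add: a_def)
    define f where "f = (\<lambda>x. \<Sum>A\<in>\<A>. complex_of_real (a A) * indicator A x)"
    have [measurable]: "f \<in> borel_measurable M" unfolding f_def using sm by auto
    have fA: "(\<lambda>x. f x * indicator A x) = (\<lambda>x. complex_of_real (a A) * indicator A x)" if A: "A \<in> \<A>" for A
    proof
      fix x
      show "f x * indicator A x = complex_of_real (a A) * indicator A x"
      proof (cases "x \<in> A")
        case True
        have "indicator B x = (0::complex)" if "B \<in> \<A>" "B \<noteq> A" for B
          using that A True dj by (auto simp: disjoint_def indicator_def)
        then have "f x = complex_of_real (a A) * indicator A x + (\<Sum>B\<in>\<A>-{A}. 0)"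
          unfolding f_def sum.remove[OF fin A] by (intro arg_cong2[where f="(+)"] sum.cong) auto
        with True show ?thesis by simp
      qed simp
    qed
    have f0: "f x = 0" if "x \<notin> \<Union>\<A>" for x
      using that unfolding f_def by (intro sum.neutral) auto
    have memA: "(\<lambda>x. f x * indicator A x) \<in> Lp_fun M p"
      and normA: "Lp_norm M p (\<lambda>x. f x * indicator A x) = 1" if A: "A \<in> \<A>" for A
    proof -
      have "0 < measure M A" using pos[OF A] fi[OF A] by (simp add: measure_def enn2real_positive_iff)
      then show "(\<lambda>x. f x * indicator A x) \<in> Lp_fun M p" "Lp_norm M p (\<lambda>x. f x * indicator A x) = 1"
        unfolding fA[OF A] using Lp_indicator[OF p sm[OF A] pos[OF A] fi[OF A] a[of A]]
        by (auto simp: a_def s_def)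
    qed
    have fle: "Lp_le M p f (m powr s * 1)"
      unfolding m_def s_def
      by (rule Lp_le_blocks[OF p fin ne dj]) (use sm f0 memA normA in \<open>auto simp: Lp_le_def\<close>)
    then have fp: "f \<in> Lp_fun M p" by (simp add: Lp_le_def)
    have fge: "m powr s * 1 \<le> Lp_norm M p f"
      unfolding m_def s_def
      by (rule Lp_norm_blocks_ge[OF p fin ne dj _ fp]) (use sm f0 normA in auto)
    have fn: "Lp_norm M p f = m powr s" using fle fge by (simp add: Lp_le_def)
    have gf: "Lp_le N q (\<lambda>x. g x * f x) (K * m powr s)" using upper[OF fp] fn by simp
    have bA: "(\<lambda>x. g x * f x * indicator A x) = (\<lambda>x. g x * (f x * indicator A x))" for A
      by (simp add: mult.assoc)
    have "\<A> \<subseteq> sets N" using sm assms(1) by auto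
    have "Lp_le N q (\<lambda>x. g x * f x) (m powr t * K)"
      unfolding m_def t_def
      by (rule Lp_le_blocks[OF q fin ne dj \<open>\<A> \<subseteq> sets N\<close>])
        (use f0 upper[OF memA] normA gf in \<open>auto simp: bA Lp_le_def Lp_fun_measurable\<close>)
    then have 1: "c * m powr s \<le> m powr t * K"
      using lower[OF fp] fn by (simp add: Lp_le_def)
    have "m powr t * c \<le> Lp_norm N q (\<lambda>x. g x * f x)"
      unfolding m_def t_def
      by (rule Lp_norm_blocks_ge[OF q fin ne dj \<open>\<A> \<subseteq> sets N\<close>])
        (use f0 lower[OF memA] normA gf c in \<open>auto simp: bA Lp_le_def\<close>)
    then have 2: "c * m powr t \<le> m powr s * K"
      using gf by (simp add: Lp_le_def mult.commute)
    have "m powr d \<le> K / c"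
    proof (cases "s \<ge> t")
      case True
      then have "m powr d = m powr s / m powr t" using m by (simp add: d_def powr_diff)
      also have "\<dots> \<le> K / c" using 1 c m by (simp add: field_simps)
      finally show ?thesis .
    next
      case False
      then have "m powr d = m powr t / m powr s" using m by (simp add: d_def powr_diff)
      also have "\<dots> \<le> K / c" using 2 c m by (simp add: field_simps)
      finally show ?thesis .
    qed
    then have "(m powr d) powr (1 / d) \<le> b" unfolding b_def using d by (intro powr_mono2) auto
    then show ?thesis using d m by (simp add: powr_powr m_def)
  qed
  note bd = this
  show ?thesis
  proof (intro exI[of _ "nat \<lceil>b\<rceil>"] allI impI)
    fix \<A> assume \<A>: "finite \<A> \<and> disjoint \<A> \<and> (\<forall>A\<in>\<A>. A \<in> sets M \<and> 0 < emeasure M A \<and> emeasure M A < \<infinity>)"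
    show "card \<A> \<le> nat \<lceil>b\<rceil>"
    proof (cases "\<A> = {}")
      case False
      then have "real (card \<A>) \<le> b" using \<A> by (intro bd) auto
      then show ?thesis by linarith
    qed simp
  qed
qed

section \<open>Finitely many atoms\<close>

lemma finite_positive_subset:
  assumes "sigma_finite_measure M" and A: "A \<in> sets M" "0 < emeasure M A"
  obtains Z where "Z \<in> sets M" "Z \<subseteq> A" "0 < emeasure M Z" "emeasure M Z < \<infinity>"
proof -
  interpret sigma_finite_measure M by fact
  show ?thesis
  proof (cases "emeasure M A = \<infinity>")
    case True
    obtain Z where "Z \<in> sets M" "Z \<subseteq> A" "emeasure M Z < \<infinity>" "ennreal 0 < emeasure M Z"
      by (rule approx_PInf_emeasure_with_finite[OF A(1) True])
    then show ?thesis by (intro that[of Z]) simp_all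
  next
    case False
    then show ?thesis by (intro that[of A]) (use A in \<open>simp_all add: less_top\<close>)
  qed
qed

text \<open>Take a disjoint family of nonnull sets of finite measure that has as many members as possible.
  Splitting a member into two nonnull parts, or adding a nonnull set disjoint from all members,
  would give a larger family; so the members are atoms and exhaust the space.\<close>

lemma finitely_many_atoms_if_card_bounded:
  assumes sf: "sigma_finite_measure M"
    and bound: "\<And>\<A>. finite \<A> \<Longrightarrow> disjoint \<A> \<Longrightarrow>
      (\<forall>A\<in>\<A>. A \<in> sets M \<and> 0 < emeasure M A \<and> emeasure M A < \<infinity>) \<Longrightarrow> card \<A> \<le> n"
  shows "finitely_many_atoms M"
proof -
  define P where "P \<A> \<longleftrightarrow> finite \<A> \<and> disjoint \<A> \<and>
    (\<forall>A\<in>\<A>. A \<in> sets M \<and> 0 < emeasure M A \<and> emeasure M A < \<infinity>)" for \<A>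
  have "P {}" by (simp add: P_def)
  moreover have "\<forall>\<A>. P \<A> \<longrightarrow> card \<A> < Suc n"
    using bound by (simp add: P_def less_Suc_eq_le)
  ultimately have "\<exists>\<A>. P \<A> \<and> (\<forall>\<B>. P \<B> \<longrightarrow> card \<B> \<le> card \<A>)"
    by (rule ex_has_greatest_nat)
  then obtain \<A> where P: "P \<A>" and max: "\<And>\<B>. P \<B> \<Longrightarrow> card \<B> \<le> card \<A>"
    by auto
  have fin: "finite \<A>" and dj: "disjoint \<A>"
    and sets: "\<And>A. A \<in> \<A> \<Longrightarrow> A \<in> sets M" and pos: "\<And>A. A \<in> \<A> \<Longrightarrow> 0 < emeasure M A"
    and finm: "\<And>A. A \<in> \<A> \<Longrightarrow> emeasure M A < \<infinity>"
    using P by (auto simp: P_def)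
  have "atom M A" if A: "A \<in> \<A>" for A
    unfolding atom_def
  proof (intro conjI ballI impI)
    show "A \<in> sets M" "0 < emeasure M A" using sets[OF A] pos[OF A] .
    fix E assume E: "E \<in> sets M" "E \<subseteq> A"
    show "emeasure M E = 0 \<or> emeasure M (A - E) = 0"
    proof (rule ccontr)
      assume "\<not> ?thesis"
      then have pE: "0 < emeasure M E" "0 < emeasure M (A - E)" by (auto simp: zero_less_iff_neq_zero)
      then have ne: "E \<noteq> {}" "A - E \<noteq> {}" by (metis emeasure_empty less_irrefl)+
      let ?B = "insert E (insert (A - E) (\<A> - {A}))"
      have new: "X \<notin> \<A> - {A}" if "X \<subseteq> A" "X \<noteq> {}" for X
        using dj A that unfolding disjoint_def by blast
      have notin: "A - E \<notin> \<A> - {A}" "E \<notin> insert (A - E) (\<A> - {A})"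
        using new[of E] new[of "A - E"] E ne by auto
      have "emeasure M E \<le> emeasure M A" "emeasure M (A - E) \<le> emeasure M A"
        using E sets[OF A] by (auto intro!: emeasure_mono)
      then have "emeasure M E < \<infinity>" "emeasure M (A - E) < \<infinity>"
        using finm[OF A] by (auto intro: le_less_trans)
      moreover have "disjoint ?B"
        using dj A E unfolding disjoint_def by blast
      ultimately have "P ?B"
        using fin sets pos finm pE E A by (auto simp: P_def)
      from max[OF this] have "card ?B \<le> card \<A>" .
      moreover have "card ?B = Suc (Suc (card (\<A> - {A})))"
        using notin fin by simp
      moreover have "card \<A> = Suc (card (\<A> - {A}))"
        by (rule card.remove[OF fin A])
      ultimately show False by simp
    qed
  qed
  moreover have "emeasure M (space M - \<Union>\<A>) = 0"
  proof (rule ccontr)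
    assume "\<not> ?thesis"
    moreover have U: "space M - \<Union>\<A> \<in> sets M" using fin sets by auto
    ultimately obtain Z where Z: "Z \<in> sets M" "Z \<subseteq> space M - \<Union>\<A>" "0 < emeasure M Z" "emeasure M Z < \<infinity>"
      using finite_positive_subset[OF sf U] by (auto simp: zero_less_iff_neq_zero)
    have "Z \<noteq> {}" using Z by auto
    then have "Z \<notin> \<A>" using Z by auto
    have "disjoint (insert Z \<A>)" using dj Z(2) unfolding disjoint_def by blast
    then have "P (insert Z \<A>)" using Z fin sets pos finm by (auto simp: P_def)
    from max[OF this] show False using \<open>Z \<notin> \<A>\<close> fin by simp
  qed
  ultimately show ?thesis using fin dj unfolding finitely_many_atoms_def by blast
qed

text \<open>The quantitative content of having finitely many atoms: the total measure is finite and the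
  measures of nonnull sets stay away from zero. A nonnull set meets some atom in a nonnull set,
  and then contains almost all of it; the atoms themselves have finite measure by
  \<open>\<sigma>\<close>-finiteness.\<close>

lemma finitely_many_atoms_imp_gap:
  assumes sf: "sigma_finite_measure M" and "finitely_many_atoms M"
  obtains d where "emeasure M (space M) < \<infinity>" "0 < d"
    "\<And>E. E \<in> sets M \<Longrightarrow> 0 < emeasure M E \<Longrightarrow> ennreal d \<le> emeasure M E"
proof -
  obtain \<A> where fin: "finite \<A>" and dj: "disjoint \<A>" and at: "\<And>A. A \<in> \<A> \<Longrightarrow> atom M A"
    and rest: "emeasure M (space M - \<Union>\<A>) = 0"
    using assms(2) by (auto simp: finitely_many_atoms_def)
  have sets: "A \<in> sets M" and pos: "0 < emeasure M A" if "A \<in> \<A>" for A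
    using at[OF that] by (auto simp: atom_def)
  have full: "emeasure M A = emeasure M (A \<inter> E)"
    if A: "A \<in> \<A>" and E: "E \<in> sets M" "0 < emeasure M (A \<inter> E)" for A E
  proof -
    have AE: "A \<inter> E \<in> sets M" "A \<inter> E \<subseteq> A" using sets[OF A] E by auto
    then have "emeasure M (A \<inter> E) = 0 \<or> emeasure M (A - A \<inter> E) = 0"
      using at[OF A] unfolding atom_def by blast
    then have "emeasure M (A - A \<inter> E) = 0" using E(2) by (metis less_irrefl)
    then have "A - A \<inter> E \<in> null_sets M" using sets[OF A] E by auto
    then have "emeasure M ((A \<inter> E) \<union> (A - A \<inter> E)) = emeasure M (A \<inter> E)"
      by (rule emeasure_Un_null_set[OF AE(1)])
    then show ?thesis by (simp add: Int_Diff_Un)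
  qed
  have finA: "emeasure M A < \<infinity>" if A: "A \<in> \<A>" for A
  proof -
    obtain Z where Z: "Z \<in> sets M" "Z \<subseteq> A" "0 < emeasure M Z" "emeasure M Z < \<infinity>"
      using finite_positive_subset[OF sf sets[OF A] pos[OF A]] .
    then have "A \<inter> Z = Z" by auto
    then show ?thesis using full[OF A Z(1)] Z by simp
  qed
  have cover: "emeasure M E \<le> (\<Sum>A\<in>\<A>. emeasure M (A \<inter> E))" if E: "E \<in> sets M" for E
  proof -
    have U: "\<Union>\<A> \<in> sets M" using fin sets by auto
    have "emeasure M (E - \<Union>\<A>) \<le> emeasure M (space M - \<Union>\<A>)"
      using U sets.sets_into_space[OF E] by (intro emeasure_mono) auto
    then have "E - \<Union>\<A> \<in> null_sets M" using rest E U by (simp add: null_sets_def)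
    then have "emeasure M (E \<inter> \<Union>\<A> \<union> (E - \<Union>\<A>)) = emeasure M (E \<inter> \<Union>\<A>)"
      by (rule emeasure_Un_null_set[OF sets.Int[OF E U]])
    then have "emeasure M E = emeasure M (E \<inter> \<Union>\<A>)" by (simp only: Int_Diff_Un)
    also have "E \<inter> \<Union>\<A> = (\<Union>A\<in>\<A>. A \<inter> E)" by auto
    also have "emeasure M \<dots> \<le> (\<Sum>A\<in>\<A>. emeasure M (A \<inter> E))"
      by (rule emeasure_subadditive_finite) (use fin sets E in auto)
    finally show ?thesis .
  qed
  \<comment> \<open>The \<open>1\<close> keeps the set nonempty when there are no atoms.\<close>
  define d where "d = Min (insert 1 (measure M ` \<A>))"
  have m: "0 < measure M A" if "A \<in> \<A>" for A
    using pos[OF that] finA[OF that] by (simp add: measure_def enn2real_positive_iff)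
  show ?thesis
  proof (rule that[of d])
    have "emeasure M (space M) \<le> (\<Sum>A\<in>\<A>. emeasure M (A \<inter> space M))" by (rule cover) simp
    also have "\<dots> = (\<Sum>A\<in>\<A>. emeasure M A)"
      using sets by (intro sum.cong) auto
    also have "\<dots> < \<infinity>" using fin finA by (simp add: less_top[symmetric])
    finally show "emeasure M (space M) < \<infinity>" .
    show "0 < d" unfolding d_def using fin m by simp
    fix E assume E: "E \<in> sets M" "0 < emeasure M E"
    have "\<exists>A\<in>\<A>. 0 < emeasure M (A \<inter> E)"
    proof (rule ccontr)
      assume "\<not> ?thesis"
      then have "(\<Sum>A\<in>\<A>. emeasure M (A \<inter> E)) = 0" by (intro sum.neutral) (auto simp: zero_less_iff_neq_zero)
      with cover[OF E(1)] E(2) show False by simp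
    qed
    then obtain A where A: "A \<in> \<A>" "0 < emeasure M (A \<inter> E)" by blast
    have "ennreal d \<le> ennreal (measure M A)"
      unfolding d_def using fin A by (intro ennreal_leI Min_le) auto
    also have "\<dots> = emeasure M A" using finA[OF A(1)] by (intro emeasure_eq_ennreal_measure[symmetric]) auto
    also have "\<dots> = emeasure M (A \<inter> E)" by (rule full[OF A(1) E(1) A(2)])
    also have "\<dots> \<le> emeasure M E" using E by (intro emeasure_mono) auto
    finally show "ennreal d \<le> emeasure M E" .
  qed
qed

lemma finitely_many_atoms_restrict_iff:
  assumes C[measurable]: "C \<in> sets M" and null: "emeasure M (space M - C) = 0"
  shows "finitely_many_atoms (restrict_space M C) \<longleftrightarrow> finitely_many_atoms M"
proof -
  have setsC: "E \<in> sets (restrict_space M C) \<longleftrightarrow> E \<in> sets M \<and> E \<subseteq> C" for E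
    using C by (auto simp: sets_restrict_space_iff)
  have emC: "emeasure (restrict_space M C) E = emeasure M E" if "E \<subseteq> C" for E
    using C that by (intro emeasure_restrict_space) auto
  have inter: "emeasure M (C \<inter> A) = emeasure M A" if A: "A \<in> sets M" for A
  proof -
    have "emeasure M (A - C) \<le> emeasure M (space M - C)"
      using sets.sets_into_space[OF A] by (intro emeasure_mono) auto
    then have "A - C \<in> null_sets M" using null A by (simp add: null_sets_def)
    then have "emeasure M (A \<inter> C \<union> (A - C)) = emeasure M (A \<inter> C)"
      by (intro emeasure_Un_null_set) (use A in auto)
    then show ?thesis by (simp only: Int_Diff_Un Int_commute[of C A])
  qed
  show ?thesis
  proof
    assume "finitely_many_atoms (restrict_space M C)"
    then obtain \<A> where \<A>: "finite \<A>" "disjoint \<A>" and at: "\<And>A. A \<in> \<A> \<Longrightarrow> atom (restrict_space M C) A"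
      and rest: "emeasure (restrict_space M C) (C - \<Union>\<A>) = 0"
      using C by (auto simp: finitely_many_atoms_def)
    have atM: "atom M A" and AC: "A \<subseteq> C" if "A \<in> \<A>" for A
    proof -
      show AC: "A \<subseteq> C" using at[OF that] by (auto simp: atom_def setsC)
      show "atom M A"
        unfolding atom_def
      proof (intro conjI ballI impI)
        show "A \<in> sets M" "0 < emeasure M A"
          using at[OF that] AC by (auto simp: atom_def setsC emC)
        fix E assume E: "E \<in> sets M" "E \<subseteq> A"
        then have "E \<in> sets (restrict_space M C)" using AC by (auto simp: setsC)
        then have "emeasure (restrict_space M C) E = 0 \<or> emeasure (restrict_space M C) (A - E) = 0"
          using at[OF that] E by (auto simp: atom_def)
        moreover have "E \<subseteq> C" "A - E \<subseteq> C" using E AC by auto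
        ultimately show "emeasure M E = 0 \<or> emeasure M (A - E) = 0"
          by (simp only: emC)
      qed
    qed
    have U: "\<Union>\<A> \<in> sets M" using \<A> atM by (auto simp: atom_def)
    have "emeasure M (space M - \<Union>\<A>) = emeasure M (C \<inter> (space M - \<Union>\<A>))"
      using U by (simp add: inter)
    also have "C \<inter> (space M - \<Union>\<A>) = C - \<Union>\<A>" using sets.sets_into_space[OF C] by auto
    also have "emeasure M \<dots> = 0" using rest by (simp add: emC)
    finally show "finitely_many_atoms M"
      using \<A> atM by (auto simp: finitely_many_atoms_def)
  next
    assume "finitely_many_atoms M"
    then obtain \<A> where \<A>: "finite \<A>" "disjoint \<A>" and at: "\<And>A. A \<in> \<A> \<Longrightarrow> atom M A"
      and rest: "emeasure M (space M - \<Union>\<A>) = 0"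
      by (auto simp: finitely_many_atoms_def)
    have atC: "atom (restrict_space M C) (C \<inter> A)" if A: "A \<in> \<A>" for A
      unfolding atom_def
    proof (intro conjI ballI impI)
      have As: "A \<in> sets M" using at[OF A] by (simp add: atom_def)
      show "C \<inter> A \<in> sets (restrict_space M C)" using As by (auto simp: setsC)
      show "0 < emeasure (restrict_space M C) (C \<inter> A)"
        using at[OF A] As by (simp add: emC inter atom_def)
      fix E assume E: "E \<in> sets (restrict_space M C)" "E \<subseteq> C \<inter> A"
      then have "E \<in> sets M" by (simp add: setsC)
      then have "emeasure M E = 0 \<or> emeasure M (A - E) = 0"
        using at[OF A] E by (auto simp: atom_def)
      moreover have "emeasure M (C \<inter> A - E) \<le> emeasure M (A - E)"
        using As \<open>E \<in> sets M\<close> by (intro emeasure_mono) auto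
      moreover have "emeasure (restrict_space M C) E = emeasure M E"
        "emeasure (restrict_space M C) (C \<inter> A - E) = emeasure M (C \<inter> A - E)"
        using E by (auto intro!: emC)
      ultimately show "emeasure (restrict_space M C) E = 0 \<or> emeasure (restrict_space M C) (C \<inter> A - E) = 0"
        by auto
    qed
    have "emeasure (restrict_space M C) (C - \<Union>((\<inter>) C ` \<A>)) = emeasure M (C - \<Union>((\<inter>) C ` \<A>))"
      by (rule emC) auto
    also have "\<dots> \<le> emeasure M (space M - \<Union>\<A>)"
    proof (rule emeasure_mono)
      show "C - \<Union>((\<inter>) C ` \<A>) \<subseteq> space M - \<Union>\<A>" using sets.sets_into_space[OF C] by auto
      show "space M - \<Union>\<A> \<in> sets M" using \<A> at by (auto simp: atom_def)
    qed
    finally have "emeasure (restrict_space M C) (C - \<Union>((\<inter>) C ` \<A>)) = 0" using rest by simp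
    moreover have "disjoint ((\<inter>) C ` \<A>)" using \<A>(2) unfolding disjoint_def by blast
    ultimately show "finitely_many_atoms (restrict_space M C)"
      using \<A>(1) atC C unfolding finitely_many_atoms_def
      by (intro exI[of _ "(\<inter>) C ` \<A>"]) auto
  qed
qed

text \<open>On such a space all the \<open>L_p\<close> norms are comparable, with
  \<open>L_\<infinity>\<close> as the intermediary. If \<open>|f|\<close> exceeds \<open>t\<close>
  on a nonnull set, that set has measure at least \<open>d\<close>, and Markov's inequality bounds
  \<open>t\<close> by the \<open>L_q\<close> norm; conversely, a bounded function is in
  \<open>L_p\<close> because the measure is finite.\<close>

lemma Lp_le_of_gap:
  assumes p: "1 \<le> p" and q: "1 \<le> q" and fin: "emeasure M (space M) < \<infinity>" and d: "0 < d"
    and gap: "\<And>E. E \<in> sets M \<Longrightarrow> 0 < emeasure M E \<Longrightarrow> ennreal d \<le> emeasure M E"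
  obtains D where "0 \<le> D" "\<And>f C. Lp_le M q f C \<Longrightarrow> Lp_le M p f (D * C)"
proof -
  have sup: "\<exists>D\<ge>0. \<forall>f C. Lp_le M q f C \<longrightarrow> (AE x in M. cmod (f x) \<le> D * C)"
  proof (cases "q = \<infinity>")
    case True
    have "AE x in M. cmod (f x) \<le> 1 * C" if L: "Lp_le M q f C" for f C
    proof -
      have "f \<in> borel_measurable M" using L by (rule Lp_le_measurable)
      then show ?thesis using L Lp_le_nonneg[OF L] by (simp add: True Lp_le_infinity_iff)
    qed
    then show ?thesis by (intro exI[of _ 1]) auto
  next
    case False
    define r where "r = enn2real q"
    have r: "0 < r" using enn2real_ge_1[OF q False] by (simp add: r_def)
    \<comment> \<open>The factor \<open>2\<close> makes Markov's inequality strict when \<open>C > 0\<close>.\<close>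
    define D where "D = (2 / d) powr (1 / r)"
    have Dr: "D powr r = 2 / d" using r d by (simp add: D_def powr_powr)
    have D: "0 < D" using d by (simp add: D_def)
    have "AE x in M. cmod (f x) \<le> D * C" if L: "Lp_le M q f C" for f C
    proof -
      have C: "0 \<le> C" using L by (rule Lp_le_nonneg)
      have [measurable]: "f \<in> borel_measurable M" using L by (rule Lp_le_measurable)
      have I: "(\<integral>\<^sup>+x. ennreal (cmod (f x) powr r) \<partial>M) \<le> ennreal (C powr r)"
        using L q False C by (simp add: Lp_le_finite_iff r_def)
      show ?thesis
      proof (cases "C = 0")
        case True
        then have "(\<integral>\<^sup>+x. ennreal (cmod (f x) powr r) \<partial>M) = 0" using I by simp
        then have "AE x in M. ennreal (cmod (f x) powr r) = 0"
          by (subst (asm) nn_integral_0_iff_AE) auto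
        then show ?thesis by eventually_elim (use True in \<open>auto simp: ennreal_eq_0_iff\<close>)
      next
        case False
        with C have C: "0 < C" by simp
        define E where "E = {x \<in> space M. D * C < cmod (f x)}"
        have E[measurable]: "E \<in> sets M" unfolding E_def by measurable
        have "emeasure M E = 0"
        proof (rule ccontr)
          assume "emeasure M E \<noteq> 0"
          then have "ennreal d \<le> emeasure M E" using gap[OF E] by (simp add: zero_less_iff_neq_zero)
          then have "ennreal ((D * C) powr r) * ennreal d \<le> ennreal ((D * C) powr r) * emeasure M E"
            by (rule mult_left_mono) simp
          also have "\<dots> = (\<integral>\<^sup>+x. ennreal ((D * C) powr r) * indicator E x \<partial>M)"
            by (simp add: nn_integral_cmult)
          also have "\<dots> \<le> (\<integral>\<^sup>+x. ennreal (cmod (f x) powr r) \<partial>M)"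
            using r D C by (intro nn_integral_mono) (auto split: split_indicator simp: E_def intro!: ennreal_leI powr_mono2)
          finally have "ennreal ((D * C) powr r * d) \<le> ennreal (C powr r)"
            using I d by (simp add: ennreal_mult)
          then have "(D * C) powr r * d \<le> C powr r" by (simp add: ennreal_le_iff)
          then have "2 * C powr r \<le> C powr r" using D C d by (simp add: powr_mult Dr)
          then show False using C by simp
        qed
        then have "AE x in M. x \<notin> E" using E by (intro AE_not_in) auto
        then show ?thesis using AE_space by eventually_elim (auto simp: E_def)
      qed
    qed
    then show ?thesis using D by (intro exI[of _ D]) auto
  qed
  then obtain D where D: "0 \<le> D" "\<And>f C. Lp_le M q f C \<Longrightarrow> AE x in M. cmod (f x) \<le> D * C" by blast
  define m where "m = measure M (space M)"
  have em: "emeasure M (space M) = ennreal m" unfolding m_def using fin by (intro emeasure_eq_ennreal_measure) auto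
  \<comment> \<open>\<open>m + 1\<close> instead of \<open>m\<close>, because \<open>0 powr 0 = 0\<close> would give \<open>k = 0\<close> for a null measure and \<open>p = \<infinity>\<close>.\<close>
  define k where "k = (m + 1) powr enn2real (1 / p)"
  have m: "0 \<le> m" by (simp add: m_def)
  have "Lp_le M p f ((k * D) * C)" if L: "Lp_le M q f C" for f C
  proof -
    have C: "0 \<le> C" using L by (rule Lp_le_nonneg)
    have [measurable]: "f \<in> borel_measurable M" using L by (rule Lp_le_measurable)
    have AE: "AE x in M. cmod (f x) \<le> D * C" by (rule D(2)[OF L])
    show ?thesis
    proof (cases "p = \<infinity>")
      case True
      then have "k = 1" using m by (simp add: k_def)
      then show ?thesis using AE C D(1) True by (simp add: Lp_le_infinity_iff)
    next
      case False
      define r where "r = enn2real p"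
      have r: "0 < r" using enn2real_ge_1[OF p False] by (simp add: r_def)
      have k: "k powr r = m + 1" using r m enn2real_inverse[OF p False] by (simp add: k_def powr_powr r_def)
      have "(\<integral>\<^sup>+x. ennreal (cmod (f x) powr r) \<partial>M) \<le> (\<integral>\<^sup>+x. ennreal ((D * C) powr r) \<partial>M)"
        by (rule nn_integral_mono_AE) (use AE r in \<open>auto intro!: ennreal_leI powr_mono2 elim!: eventually_mono\<close>)
      also have "\<dots> = ennreal ((D * C) powr r * m)" using em m by (simp add: ennreal_mult)
      also have "\<dots> \<le> ennreal ((k * D * C) powr r)"
      proof (rule ennreal_leI)
        have "(k * D * C) powr r = k powr r * (D * C) powr r"
          using D(1) C by (simp add: powr_mult k_def mult.assoc)
        then show "(D * C) powr r * m \<le> (k * D * C) powr r"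
          by (simp add: k distrib_right mult.commute)
      qed
      finally show ?thesis using p False C D(1) by (simp add: Lp_le_finite_iff r_def k_def)
    qed
  qed
  moreover have "0 \<le> k * D" using D(1) by (simp add: k_def)
  ultimately show ?thesis using that by blast
qed

section \<open>Multiplication into a weighted space\<close>

text \<open>The operator into the weighted space is the operator of multiplication by \<open>w\<close>,
  \<open>g\<close> times the root of the density, from \<open>L_p\<close> to \<open>L_q\<close>
  over one and the same measure. If \<open>w\<close> were smaller than \<open>e\<close> in modulus
  on a nonnull set \<open>E\<close> of finite measure, testing on the indicator of
  \<open>E\<close> would give \<open>c * measure M E powr (1 / p - 1 / q) \<le> e\<close>. The
  left side is bounded below: the exponent is zero for \<open>p = q\<close>, and otherwise the
  measures of nonnull sets lie between two positive constants.\<close>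

lemma density_multiplier_lower_bound:
  fixes \<rho> :: "'a \<Rightarrow> real"
  assumes sf: "sigma_finite_measure M" and p: "1 \<le> p" and q: "1 \<le> q"
    and g[measurable]: "g \<in> borel_measurable M"
    and \<rho>[measurable]: "\<rho> \<in> borel_measurable M" and \<rho>0: "AE x in M. 0 \<le> \<rho> x"
    and upper: "\<And>f. f \<in> Lp_fun M p \<Longrightarrow>
      Lp_le (density M (\<lambda>x. ennreal (\<rho> x))) q (\<lambda>x. g x * f x) (K * Lp_norm M p f)"
    and c: "0 < c"
    and lower: "\<And>f. f \<in> Lp_fun M p \<Longrightarrow>
      c * Lp_norm M p f \<le> Lp_norm (density M (\<lambda>x. ennreal (\<rho> x))) q (\<lambda>x. g x * f x)"
  shows "p \<noteq> q \<Longrightarrow> finitely_many_atoms M"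
    and "\<exists>c>0. AE x in M. c \<le> cmod (g x * complex_of_real (\<rho> x powr enn2real (1 / q)))"
proof -
  define w where "w x = complex_of_real (\<rho> x powr enn2real (1 / q)) * g x" for x
  have w[measurable]: "w \<in> borel_measurable M" unfolding w_def by measurable
  define s where "s = enn2real (1 / p) - enn2real (1 / q)"
  show atoms: "finitely_many_atoms M" if "p \<noteq> q"
  proof -
    obtain n where "\<forall>\<A>. finite \<A> \<and> disjoint \<A> \<and>
        (\<forall>A\<in>\<A>. A \<in> sets M \<and> 0 < emeasure M A \<and> emeasure M A < \<infinity>) \<longrightarrow> card \<A> \<le> n"
      using disjoint_family_bound[OF sets_density p q \<open>p \<noteq> q\<close> g upper c lower] by blast
    then show ?thesis using finitely_many_atoms_if_card_bounded[OF sf, of n] by blast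
  qed
  have "\<exists>b>0. \<forall>E\<in>sets M. 0 < emeasure M E \<longrightarrow> emeasure M E < \<infinity> \<longrightarrow> b \<le> measure M E powr s"
  proof (cases "p = q")
    case True
    have "1 \<le> measure M E powr s" if "0 < emeasure M E" "emeasure M E < \<infinity>" for E
    proof -
      have "0 < measure M E" using that by (simp add: measure_def enn2real_positive_iff)
      then show ?thesis using True by (simp add: s_def)
    qed
    then show ?thesis by (intro exI[of _ 1]) auto
  next
    case False
    obtain d where fin: "emeasure M (space M) < \<infinity>" and d: "0 < d"
      and gap: "\<And>E. E \<in> sets M \<Longrightarrow> 0 < emeasure M E \<Longrightarrow> ennreal d \<le> emeasure M E"
      by (rule finitely_many_atoms_imp_gap[OF sf atoms[OF False]]) blast
    define m where "m = measure M (space M) + 1"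
    have m: "0 < m" by (simp add: m_def add_nonneg_pos)
    have "min (d powr s) (m powr s) \<le> measure M E powr s"
      if E: "E \<in> sets M" and pos: "0 < emeasure M E" and fE: "emeasure M E < \<infinity>" for E
    proof -
      have em: "emeasure M E = ennreal (measure M E)" using fE by (intro emeasure_eq_ennreal_measure) auto
      have dE: "d \<le> measure M E" using gap[OF E pos] em by (simp add: ennreal_le_iff)
      have "emeasure M E \<le> emeasure M (space M)" by (rule emeasure_space)
      then have "measure M E \<le> measure M (space M)"
        using fin unfolding measure_def by (intro enn2real_mono) auto
      then have mE: "measure M E \<le> m" by (simp add: m_def)
      show ?thesis
      proof (cases "0 \<le> s")
        case True
        have "d powr s \<le> measure M E powr s" using True d dE by (intro powr_mono2) auto
        then show ?thesis by simp
      next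
        case False
        have "m powr s \<le> measure M E powr s" using False d dE mE by (intro powr_mono2') auto
        then show ?thesis by simp
      qed
    qed
    then show ?thesis using d m by (intro exI[of _ "min (d powr s) (m powr s)"]) auto
  qed
  then obtain b where b: "0 < b"
    and bE: "\<And>E. E \<in> sets M \<Longrightarrow> 0 < emeasure M E \<Longrightarrow> emeasure M E < \<infinity> \<Longrightarrow> b \<le> measure M E powr s"
    by blast
  \<comment> \<open>Half of the bound that the test on indicators allows, so that falling below it is a contradiction.\<close>
  define e where "e = c * b / 2"
  have e: "0 < e" using b c by (simp add: e_def)
  define B where "B = {x \<in> space M. cmod (w x) < e}"
  have B[measurable]: "B \<in> sets M" unfolding B_def by measurable
  have "emeasure M B = 0"
  proof (rule ccontr)
    assume "emeasure M B \<noteq> 0"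
    then have "0 < emeasure M B" by (simp add: zero_less_iff_neq_zero)
    then obtain E where E[measurable]: "E \<in> sets M" and EB: "E \<subseteq> B"
      and pos: "0 < emeasure M E" and fin: "emeasure M E < \<infinity>"
      using finite_positive_subset[OF sf B] by blast
    define f where "f = (\<lambda>x. complex_of_real 1 * indicator E x)"
    have m: "0 < measure M E" using pos fin by (simp add: measure_def enn2real_positive_iff)
    have fp: "f \<in> Lp_fun M p" and np: "Lp_norm M p f = measure M E powr enn2real (1 / p)"
      unfolding f_def using Lp_indicator[OF p E pos fin, of 1] by auto
    have fq: "f \<in> Lp_fun M q" and nq: "Lp_norm M q f = measure M E powr enn2real (1 / q)"
      unfolding f_def using Lp_indicator[OF q E pos fin, of 1] by auto
    have [measurable]: "f \<in> borel_measurable M" using fp by (rule Lp_fun_measurable)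
    have "Lp_le M q (\<lambda>x. w x * f x) (e * Lp_norm M q f)"
    proof (rule Lp_le_mono[OF q Lp_le_Lp_norm[OF fq]])
      have "cmod (w x * f x) \<le> e * cmod (f x)" for x
        using EB by (auto simp: f_def B_def split: split_indicator)
      then show "AE x in M. cmod (w x * f x) \<le> e * cmod (f x)" by simp
    qed (use e in auto)
    then have "Lp_le (density M (\<lambda>x. ennreal (\<rho> x))) q (\<lambda>x. g x * f x) (e * Lp_norm M q f)"
      using e by (subst Lp_le_density_iff[OF q \<rho> \<rho>0]) (simp_all add: w_def Lp_norm_nonneg mult.assoc)
    then have "c * Lp_norm M p f \<le> e * Lp_norm M q f"
      using lower[OF fp] by (simp add: Lp_le_def)
    then have "c * measure M E powr s \<le> e"
      using m by (simp add: np nq s_def powr_diff field_simps)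
    moreover have "c * b \<le> c * measure M E powr s"
      using bE[OF E pos fin] c by simp
    ultimately have "c * b \<le> e" by linarith
    moreover have "0 < c * b" using b c by simp
    ultimately show False unfolding e_def by linarith
  qed
  then have "AE x in M. x \<notin> B" using B by (intro AE_not_in) auto
  then have "AE x in M. e \<le> cmod (g x * complex_of_real (\<rho> x powr enn2real (1 / q)))"
    using AE_space
  proof eventually_elim
    case (elim x)
    then have "e \<le> cmod (w x)" by (auto simp: B_def)
    then show ?case by (simp add: w_def mult.commute)
  qed
  then show "\<exists>c>0. AE x in M. c \<le> cmod (g x * complex_of_real (\<rho> x powr enn2real (1 / q)))"
    using e by blast
qed

text \<open>Since \<open>w\<close> is bounded away from zero, \<open>h / g\<close> is dominated by
  \<open>h\<close> times the root of the density, whose \<open>L_q\<close> norm is that of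
  \<open>h\<close> in the weighted space; for \<open>p \<noteq> q\<close> the comparability of
  norms passes from \<open>L_q\<close> to \<open>L_p\<close>.\<close>

lemma density_multiplier_inverse_bound:
  fixes \<rho> :: "'a \<Rightarrow> real"
  assumes sf: "sigma_finite_measure M" and p: "1 \<le> p" and q: "1 \<le> q"
    and g[measurable]: "g \<in> borel_measurable M"
    and \<rho>[measurable]: "\<rho> \<in> borel_measurable M" and \<rho>0: "AE x in M. 0 \<le> \<rho> x"
    and c: "0 < c" and w: "AE x in M. c \<le> cmod (g x * complex_of_real (\<rho> x powr enn2real (1 / q)))"
    and atoms: "p \<noteq> q \<Longrightarrow> finitely_many_atoms M"
  obtains K where "0 \<le> K" "\<And>h. h \<in> Lp_fun (density M (\<lambda>x. ennreal (\<rho> x))) q \<Longrightarrow>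
    Lp_le M p (\<lambda>x. inverse (g x) * h x) (K * Lp_norm (density M (\<lambda>x. ennreal (\<rho> x))) q h)"
proof -
  let ?N = "density M (\<lambda>x. ennreal (\<rho> x))"
  have "\<exists>D\<ge>0. \<forall>f C. Lp_le M q f C \<longrightarrow> Lp_le M p f (D * C)"
  proof (cases "p = q")
    case True
    then show ?thesis by (intro exI[of _ 1]) auto
  next
    case False
    obtain d where "emeasure M (space M) < \<infinity>" "0 < d"
      "\<And>E. E \<in> sets M \<Longrightarrow> 0 < emeasure M E \<Longrightarrow> ennreal d \<le> emeasure M E"
      by (rule finitely_many_atoms_imp_gap[OF sf atoms[OF False]]) blast
    then obtain D where "0 \<le> D" "\<And>f C. Lp_le M q f C \<Longrightarrow> Lp_le M p f (D * C)"
      using Lp_le_of_gap[OF p q] by blast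
    then show ?thesis by blast
  qed
  then obtain D where D: "0 \<le> D" "\<And>f C. Lp_le M q f C \<Longrightarrow> Lp_le M p f (D * C)" by blast
  have "Lp_le M p (\<lambda>x. inverse (g x) * h x) (D * (1 / c) * Lp_norm ?N q h)" if h: "h \<in> Lp_fun ?N q" for h
  proof -
    have hm[measurable]: "h \<in> borel_measurable M" using Lp_fun_measurable[OF h] by simp
    let ?h = "\<lambda>x. complex_of_real (\<rho> x powr enn2real (1 / q)) * h x"
    have "Lp_le M q ?h (Lp_norm ?N q h)"
      using Lp_le_Lp_norm[OF h] Lp_le_density_iff[OF q \<rho> \<rho>0 hm Lp_norm_nonneg[of ?N q h]] by simp
    then have "Lp_le M q (\<lambda>x. inverse (g x) * h x) (1 / c * Lp_norm ?N q h)"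
    proof (rule Lp_le_mono[OF q])
      show "AE x in M. cmod (inverse (g x) * h x) \<le> 1 / c * cmod (?h x)"
        using w
      proof eventually_elim
        case (elim x)
        have g0: "g x \<noteq> 0" using elim c by auto
        have "cmod (h x) * c \<le> cmod (h x) * (cmod (g x) * \<bar>\<rho> x powr enn2real (1 / q)\<bar>)"
          using elim by (intro mult_left_mono) (auto simp: norm_mult)
        then show ?case using g0 c by (simp add: norm_mult norm_divide norm_inverse field_simps)
      qed
    qed (use c in auto)
    from D(2)[OF this] show ?thesis by (simp add: mult.assoc)
  qed
  moreover have "0 \<le> D * (1 / c)" using D c by simp
  ultimately show ?thesis using that by blast
qed

section \<open>Restriction to the continuous part\<close>

lemma restrict_density:
  fixes \<rho> :: "'a \<Rightarrow> real"
  assumes s: "sets N = sets M" and C: "C \<in> sets M" and \<rho>[measurable]: "\<rho> \<in> borel_measurable M"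
    and N: "\<And>E. E \<in> sets M \<Longrightarrow> E \<subseteq> C \<Longrightarrow> emeasure N E = emeasure (density M (\<lambda>x. ennreal (\<rho> x))) E"
  shows "restrict_space N C = density (restrict_space M C) (\<lambda>x. ennreal (\<rho> x))"
proof (rule measure_eqI)
  show sC: "sets (restrict_space N C) = sets (density (restrict_space M C) (\<lambda>x. ennreal (\<rho> x)))"
    using sets_restrict_space_cong[OF s] by simp
  fix E assume "E \<in> sets (restrict_space N C)"
  then have E: "E \<in> sets M" "E \<subseteq> C" and Er: "E \<in> sets (restrict_space M C)"
    using s C sC by (auto simp: sets_restrict_space_iff)
  note [measurable] = E(1) C
  have \<rho>C: "(\<lambda>x. ennreal (\<rho> x)) \<in> borel_measurable (restrict_space M C)"
    by (rule measurable_restrict_space1) simp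
  have "emeasure (restrict_space N C) E = emeasure N E"
    using E C s by (intro emeasure_restrict_space) auto
  also have "\<dots> = (\<integral>\<^sup>+x. ennreal (\<rho> x) * indicator E x \<partial>M)"
    using N[OF E] E by (simp add: emeasure_density)
  also have "\<dots> = (\<integral>\<^sup>+x. ennreal (\<rho> x) * indicator E x * indicator C x \<partial>M)"
    using E by (intro nn_integral_cong) (auto split: split_indicator)
  also have "\<dots> = (\<integral>\<^sup>+x. ennreal (\<rho> x) * indicator E x \<partial>restrict_space M C)"
    using C by (intro nn_integral_restrict_space[symmetric]) auto
  also have "\<dots> = emeasure (density (restrict_space M C) (\<lambda>x. ennreal (\<rho> x))) E"
    by (rule emeasure_density[OF \<rho>C Er, symmetric])
  finally show "emeasure (restrict_space N C) E = emeasure (density (restrict_space M C) (\<lambda>x. ennreal (\<rho> x))) E" .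
qed

lemma Lp_restrict_space:
  assumes p: "1 \<le> p" and C: "C \<in> sets M" and f: "f \<in> borel_measurable M"
    and zero: "AE x in M. x \<notin> C \<longrightarrow> f x = 0"
  shows "f \<in> Lp_fun (restrict_space M C) p \<longleftrightarrow> f \<in> Lp_fun M p"
    and "f \<in> Lp_fun M p \<Longrightarrow> Lp_norm (restrict_space M C) p f = Lp_norm M p f"
  using Lp_fun_norm_eqI[OF Lp_le_restrict_iff[OF p C f zero]] by auto

text \<open>Take \<open>f'\<close> to be \<open>f\<close> extended by zero: then both \<open>f'\<close> and
  \<open>g * f'\<close> vanish off \<open>C\<close>, whatever the measures do there, so their
  norms are those on \<open>C\<close>.\<close>

lemma Lp_restrict_space_extend:
  assumes p: "1 \<le> p" and q: "1 \<le> q" and s: "sets N = sets M" and C: "C \<in> sets M"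
    and g: "g \<in> borel_measurable M"
    and f: "f \<in> Lp_fun (restrict_space M C) p"
  obtains f' where "f' \<in> Lp_fun M p" "Lp_norm (restrict_space M C) p f = Lp_norm M p f'"
    "(\<lambda>x. g x * f x) \<in> Lp_fun (restrict_space N C) q \<longleftrightarrow> (\<lambda>x. g x * f' x) \<in> Lp_fun N q"
    "(\<lambda>x. g x * f' x) \<in> Lp_fun N q \<Longrightarrow>
      Lp_norm (restrict_space N C) q (\<lambda>x. g x * f x) = Lp_norm N q (\<lambda>x. g x * f' x)"
proof -
  define f' where "f' = (\<lambda>x. indicator C x *\<^sub>R f x)"
  have fC: "f \<in> borel_measurable (restrict_space M C)" using f by (rule Lp_fun_measurable)
  then have f'M: "f' \<in> borel_measurable M"
    unfolding f'_def using C by (subst (asm) borel_measurable_restrict_space_iff) auto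
  have f'C: "f' \<in> borel_measurable (restrict_space M C)" using f'M by (rule measurable_restrict_space1)
  have eq: "f x = f' x" if "x \<in> C" for x using that by (simp add: f'_def)
  have M_eq: "(f, f') \<in> ae_eq (restrict_space M C)"
    using fC f'C eq C by (auto simp: ae_eq_def AE_restrict_space_iff)
  have ms: "borel_measurable N = borel_measurable M"
    using s by (intro measurable_cong_sets) auto
  have msC: "borel_measurable (restrict_space N C) = borel_measurable (restrict_space M C)"
    using sets_restrict_space_cong[OF s] by (intro measurable_cong_sets) auto
  have CN: "C \<in> sets N" using C s by simp
  have gC: "g \<in> borel_measurable (restrict_space M C)" using g by (rule measurable_restrict_space1)
  have N_eq: "(\<lambda>x. g x * f x, \<lambda>x. g x * f' x) \<in> ae_eq (restrict_space N C)"
    using fC f'C gC eq CN by (auto simp: ae_eq_def msC AE_restrict_space_iff)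
  have gf': "(\<lambda>x. g x * f' x) \<in> borel_measurable N" using g f'M by (simp add: ms)
  have zM: "AE x in M. x \<notin> C \<longrightarrow> f' x = 0" by (simp add: f'_def)
  have zN: "AE x in N. x \<notin> C \<longrightarrow> g x * f' x = 0" by (simp add: f'_def)
  have mem: "f' \<in> Lp_fun M p"
    using f Lp_fun_cong[OF M_eq] Lp_restrict_space(1)[OF p C f'M zM] by blast
  show ?thesis
  proof (rule that[of f'])
    show "Lp_norm (restrict_space M C) p f = Lp_norm M p f'"
      using Lp_norm_cong[OF M_eq] Lp_restrict_space(2)[OF p C f'M zM mem] by simp
    show "(\<lambda>x. g x * f x) \<in> Lp_fun (restrict_space N C) q \<longleftrightarrow> (\<lambda>x. g x * f' x) \<in> Lp_fun N q"
      using Lp_fun_cong[OF N_eq] Lp_restrict_space(1)[OF q CN gf' zN] by blast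
    show "Lp_norm (restrict_space N C) q (\<lambda>x. g x * f x) = Lp_norm N q (\<lambda>x. g x * f' x)"
      if "(\<lambda>x. g x * f' x) \<in> Lp_fun N q"
      using Lp_norm_cong[OF N_eq] Lp_restrict_space(2)[OF q CN gf' zN that] by simp
  qed (rule mem)
qed

section \<open>The equivalence\<close>

theorem theorem2p1p7:
  fixes M N Ns :: "'a measure" and p q :: ennreal and g :: "'a \<Rightarrow> complex"
    and \<rho> :: "'a \<Rightarrow> real" and \<Omega>s \<Omega>c :: "'a set"
  assumes "sigma_finite_measure M" and "sigma_finite_measure N" and "sets N = sets M"
    and "1 \<le> p" and "1 \<le> q"
    and "g \<in> borel_measurable M"
    and "bounded_operator (Lp M p) (Lp N q) (mult_op N g)"
    and "lebesgue_decomposition M N \<rho> Ns \<Omega>s"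
    and "\<Omega>c = space M - \<Omega>s"
  defines "i \<equiv> topologically_injective (Lp M p) (Lp N q) (mult_op N g)"
    and "ii \<equiv> isomorphism (Lp (restrict_space M \<Omega>c) p) (Lp (restrict_space N \<Omega>c) q)
                 (mult_op (restrict_space N \<Omega>c) g)"
    and "iii \<equiv> (AE x in M. \<rho> x > 0) \<and>
           (\<exists>c>0. AE x in restrict_space M \<Omega>c.
              cmod (g x * complex_of_real (\<rho> x powr enn2real (1 / q))) \<ge> c) \<and>
           (p \<noteq> q \<longrightarrow> finitely_many_atoms M)"
  shows "(i \<longleftrightarrow> ii) \<and> (ii \<longleftrightarrow> iii)"
proof -
  note s = \<open>sets N = sets M\<close>
  note p = \<open>1 \<le> p\<close> and q = \<open>1 \<le> q\<close>
  note g[measurable] = \<open>g \<in> borel_measurable M\<close>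
  note bounded = assms(7)
  define Mc where "Mc = restrict_space M \<Omega>c"
  define Nc where "Nc = restrict_space N \<Omega>c"
  have \<rho>[measurable]: "\<rho> \<in> borel_measurable M" and \<rho>0: "AE x in M. 0 \<le> \<rho> x"
    and setsNs: "sets Ns = sets M"
    and dec: "\<And>E. E \<in> sets M \<Longrightarrow> emeasure N E = emeasure (density M (\<lambda>x. ennreal (\<rho> x))) E + emeasure Ns E"
    and S: "\<Omega>s \<in> sets M" "emeasure M \<Omega>s = 0" and Ns0: "emeasure Ns (space M - \<Omega>s) = 0"
    using assms(8) by (auto simp: lebesgue_decomposition_def)
  have C: "\<Omega>c \<in> sets M" using S assms(9) by auto
  have sp: "space N = space M" using s by (rule sets_eq_imp_space_eq)
  have S_null: "\<Omega>s \<in> null_sets M" using S by (simp add: null_sets_def)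
  have M0: "AE x in M. x \<in> \<Omega>c"
    using AE_not_in[OF S_null] AE_space by eventually_elim (simp add: assms(9))
  have MC0: "emeasure M (space M - \<Omega>c) = 0"
    using S sets.sets_into_space[OF S(1)] by (simp add: assms(9) double_diff)
  obtain K where nc: "null_compatible M N g" and K: "0 \<le> K"
    and upper: "\<And>f. f \<in> Lp_fun M p \<Longrightarrow> Lp_le N q (\<lambda>x. g x * f x) (K * Lp_norm M p f)"
    using bounded bounded_mult_op_iff[OF s g p q] by auto
  \<comment> \<open>Well-definedness makes the singular part of the second measure invisible to the operator.\<close>
  have "AE x in N. x \<in> \<Omega>s \<longrightarrow> g x = 0"
    using nc S_null unfolding null_compatible_def by blast
  then have N0: "AE x in N. x \<notin> \<Omega>c \<longrightarrow> g x = 0"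
    using AE_space by eventually_elim (simp add: assms(9) sp)

  have "emeasure N E = emeasure (density M (\<lambda>x. ennreal (\<rho> x))) E" if E: "E \<in> sets M" "E \<subseteq> \<Omega>c" for E
  proof -
    have "emeasure Ns E \<le> emeasure Ns (space M - \<Omega>s)"
      using E S setsNs assms(9) by (intro emeasure_mono) auto
    then show ?thesis using dec[OF E(1)] Ns0 by simp
  qed
  then have Nc: "Nc = density Mc (\<lambda>x. ennreal (\<rho> x))"
    unfolding Nc_def Mc_def by (rule restrict_density[OF s C \<rho>])
  have sc: "sets Nc = sets Mc" unfolding Nc by simp
  have gc[measurable]: "g \<in> borel_measurable Mc" and \<rho>c[measurable]: "\<rho> \<in> borel_measurable Mc"
    unfolding Mc_def using g \<rho> by (auto intro: measurable_restrict_space1)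
  have AE_Mc: "(AE x in Mc. P x) \<longleftrightarrow> (AE x in M. P x)" for P
  proof -
    have "(AE x in Mc. P x) \<longleftrightarrow> (AE x in M. x \<in> \<Omega>c \<longrightarrow> P x)"
      unfolding Mc_def using C by (simp add: AE_restrict_space_iff)
    also have "\<dots> \<longleftrightarrow> (AE x in M. P x)"
      (is "?L \<longleftrightarrow> ?R")
    proof
      assume ?L with M0 show ?R by eventually_elim simp
    next
      assume ?R then show ?L by eventually_elim simp
    qed
    finally show ?thesis .
  qed
  have \<rho>0c: "AE x in Mc. 0 \<le> \<rho> x" using \<rho>0 by (simp only: AE_Mc)
  have sfc: "sigma_finite_measure Mc"
    unfolding Mc_def using assms(1) C by (rule sigma_finite_measure_restrict_space)
  have AE_Nc: "AE x in Nc. P x" if "AE x in Mc. P x" for P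
    unfolding Nc using that by (subst AE_density) (auto elim: eventually_mono)

  \<comment> \<open>Upper and lower bounds are carried between the whole space and the continuous part.\<close>
  note extend = Lp_restrict_space_extend[OF p q s C g, folded Mc_def Nc_def]
  have upper_c: "Lp_le Nc q (\<lambda>x. g x * f x) (K * Lp_norm Mc p f)" if f: "f \<in> Lp_fun Mc p" for f
  proof -
    obtain f' where f': "f' \<in> Lp_fun M p" "Lp_norm Mc p f = Lp_norm M p f'"
      "(\<lambda>x. g x * f x) \<in> Lp_fun Nc q \<longleftrightarrow> (\<lambda>x. g x * f' x) \<in> Lp_fun N q"
      "(\<lambda>x. g x * f' x) \<in> Lp_fun N q \<Longrightarrow> Lp_norm Nc q (\<lambda>x. g x * f x) = Lp_norm N q (\<lambda>x. g x * f' x)"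
      using extend[OF f] by blast
    show ?thesis using upper[OF f'(1)] f' by (simp add: Lp_le_def)
  qed
  have "null_compatible Mc Nc g"
    unfolding null_compatible_def
  proof
    fix A assume "A \<in> null_sets Mc"
    from AE_Nc[OF AE_not_in[OF this]] show "AE x in Nc. x \<in> A \<longrightarrow> g x = 0"
      by eventually_elim simp
  qed
  then have bounded_c: "bounded_operator (Lp Mc p) (Lp Nc q) (mult_op Nc g)"
    using K upper_c bounded_mult_op_iff[OF sc gc p q] by blast

  define L where "L \<longleftrightarrow> (\<exists>c>0. \<forall>f\<in>Lp_fun Mc p. c * Lp_norm Mc p f \<le> Lp_norm Nc q (\<lambda>x. g x * f x))"
  have i_L: "i \<longleftrightarrow> L"
  proof
    assume i
    then obtain c where c: "0 < c"
      and lower: "\<And>f. f \<in> Lp_fun M p \<Longrightarrow> c * Lp_norm M p f \<le> Lp_norm N q (\<lambda>x. g x * f x)"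
      unfolding i_def using topologically_injective_mult_op_iff[OF s g p q bounded] by blast
    have "c * Lp_norm Mc p f \<le> Lp_norm Nc q (\<lambda>x. g x * f x)" if f: "f \<in> Lp_fun Mc p" for f
    proof -
      obtain f' where f': "f' \<in> Lp_fun M p" "Lp_norm Mc p f = Lp_norm M p f'"
        "(\<lambda>x. g x * f' x) \<in> Lp_fun N q \<Longrightarrow> Lp_norm Nc q (\<lambda>x. g x * f x) = Lp_norm N q (\<lambda>x. g x * f' x)"
        using extend[OF f] by blast
      show ?thesis using lower[OF f'(1)] upper[OF f'(1)] f' by (simp add: Lp_le_def)
    qed
    then show L unfolding L_def using c by blast
  next
    assume L
    then obtain c where c: "0 < c"
      and lower: "\<And>f. f \<in> Lp_fun Mc p \<Longrightarrow> c * Lp_norm Mc p f \<le> Lp_norm Nc q (\<lambda>x. g x * f x)"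
      unfolding L_def by blast
    have "c * Lp_norm M p f \<le> Lp_norm N q (\<lambda>x. g x * f x)" if f: "f \<in> Lp_fun M p" for f
    proof -
      have fm: "f \<in> borel_measurable M" using f by (rule Lp_fun_measurable)
      have zM: "AE x in M. x \<notin> \<Omega>c \<longrightarrow> f x = 0" using M0 by eventually_elim simp
      have zN: "AE x in N. x \<notin> \<Omega>c \<longrightarrow> g x * f x = 0" using N0 by eventually_elim simp
      have gf: "(\<lambda>x. g x * f x) \<in> Lp_fun N q" using upper[OF f] by (simp add: Lp_le_def)
      have "f \<in> Lp_fun Mc p" "Lp_norm Mc p f = Lp_norm M p f"
        unfolding Mc_def using Lp_restrict_space[OF p C fm zM] f by auto
      moreover have "Lp_norm Nc q (\<lambda>x. g x * f x) = Lp_norm N q (\<lambda>x. g x * f x)"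
        unfolding Nc_def using C s
        by (intro Lp_restrict_space(2)[OF q _ Lp_fun_measurable[OF gf] zN gf]) simp
      ultimately show ?thesis using lower by metis
    qed
    then show i
      unfolding i_def using c topologically_injective_mult_op_iff[OF s g p q bounded] by blast
  qed
  have ii_L: "L" if ii
  proof -
    have "isomorphism (Lp Mc p) (Lp Nc q) (mult_op Nc g)" using that by (simp add: ii_def Mc_def Nc_def)
    moreover have "0 \<le> nrm (Lp Nc q) F" if "F \<in> carrier (Lp Nc q)" for F
      using that by (auto simp: carrier_Lp nrm_Lp_class Lp_fun_measurable Lp_norm_nonneg)
    ultimately have "topologically_injective (Lp Mc p) (Lp Nc q) (mult_op Nc g)"
      by (rule isomorphism_imp_topologically_injective)
    then show L
      unfolding L_def using topologically_injective_mult_op_iff[OF sc gc p q bounded_c] by blast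
  qed
  let ?w = "\<lambda>x. cmod (g x * complex_of_real (\<rho> x powr enn2real (1 / q)))"
  have L_iii: iii if hL: L
  proof -
    obtain c where c: "0 < c"
      and lower: "\<And>f. f \<in> Lp_fun Mc p \<Longrightarrow> c * Lp_norm Mc p f \<le> Lp_norm Nc q (\<lambda>x. g x * f x)"
      using hL unfolding L_def by blast
    note low = density_multiplier_lower_bound[OF sfc p q gc \<rho>c \<rho>0c upper_c[unfolded Nc] c lower[unfolded Nc]]
    obtain c' where c': "0 < c'" "AE x in Mc. c' \<le> ?w x" using low(2) by blast
    have "AE x in Mc. 0 < \<rho> x"
      using c'(2) \<rho>0c
    proof eventually_elim
      case (elim x)
      \<comment> \<open>A zero of \<open>\<rho>\<close> would be a zero of its power, also for the exponent \<open>0\<close>.\<close>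
      then have "\<rho> x \<noteq> 0" using c'(1) by auto
      with elim show ?case by simp
    qed
    then have "AE x in M. 0 < \<rho> x" by (simp only: AE_Mc)
    moreover have "finitely_many_atoms M" if "p \<noteq> q"
      using low(1)[OF _ _ that] finitely_many_atoms_restrict_iff[OF C MC0] by (simp add: Mc_def)
    ultimately show iii
      unfolding iii_def using c' unfolding Mc_def by blast
  qed
  have iii_ii: ii if iii: iii
  proof -
    have "AE x in M. 0 < \<rho> x" using iii by (simp add: iii_def)
    then have \<rho>pos: "AE x in Mc. 0 < \<rho> x" by (simp only: AE_Mc)
    obtain c where c: "0 < c" "AE x in Mc. c \<le> ?w x"
      using iii unfolding iii_def Mc_def by blast
    have atoms: "finitely_many_atoms Mc" if "p \<noteq> q"
      using that iii finitely_many_atoms_restrict_iff[OF C MC0] by (simp add: iii_def Mc_def)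
    define k where "k = (\<lambda>x. inverse (g x))"
    have k[measurable]: "k \<in> borel_measurable Mc" unfolding k_def by measurable
    obtain K' where K': "0 \<le> K'"
      "\<And>h. h \<in> Lp_fun Nc q \<Longrightarrow> Lp_le Mc p (\<lambda>x. k x * h x) (K' * Lp_norm Nc q h)"
      using density_multiplier_inverse_bound[OF sfc p q gc \<rho>c \<rho>0c c atoms] unfolding Nc k_def by blast
    have "null_compatible Nc Mc k"
      unfolding null_compatible_def
    proof
      fix A assume "A \<in> null_sets Nc"
      then have "AE x in Nc. x \<notin> A" by (rule AE_not_in)
      then have "AE x in Mc. 0 < \<rho> x \<longrightarrow> x \<notin> A" unfolding Nc by (subst (asm) AE_density) auto
      with \<rho>pos show "AE x in Mc. x \<in> A \<longrightarrow> k x = 0" by eventually_elim simp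
    qed
    moreover have kN: "k \<in> borel_measurable Nc" unfolding Nc by simp
    ultimately have bk: "bounded_operator (Lp Nc q) (Lp Mc p) (mult_op Mc k)"
      using K' bounded_mult_op_iff[OF sc[symmetric] kN q p] by blast
    have g0: "AE x in Mc. g x \<noteq> 0" using c(2) by eventually_elim (use c(1) in auto)
    have "isomorphism (Lp Mc p) (Lp Nc q) (mult_op Nc g)"
    proof (rule isomorphism_mult_op[OF sc gc k p q bounded_c bk])
      show "AE x in Mc. k x * g x = 1" using g0 by eventually_elim (simp add: k_def)
      show "AE x in Nc. g x * k x = 1" using AE_Nc[OF g0] by eventually_elim (simp add: k_def)
    qed
    then show ii by (simp add: ii_def Mc_def Nc_def)
  qed
  from i_L ii_L L_iii iii_ii show ?thesis by blast
qed

end
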